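(* Let $d=1$. For any $1\le p<\infty$, $0<q\le\infty$ and any function $\psi\in\mathfrak M^c_\infty$, $$\sigma_m^\perp(\mathcal F_q^\psi)_{L_p(\mathbb T^1)}\asymp G_m(\mathcal F_q^\psi)_{L_p(\mathbb T^1)}\asymp\mathscr D_m^\perp(\mathcal F_q^\psi)_{L_p(\mathbb T^1)}\asymp\psi\big(\tfrac m2\big)\asymp\psi\big(\big[\tfrac{m+1}2\big]\big)$$ (where the quantity $\psi(\frac m2)$ is considered for $m\ge2$).
   Context: $[x]$ is the greatest integer in $x$. $L_p(\mathbb T^1)$, $\mathbb T^1=[0,2\pi)$, is the space of $2\pi$-periodic functions with norm $\|f\|_{L_p}=((2\pi)^{-1}\int_0^{2\pi}|f|^p\,dx)^{1/p}$. $e_k(x)=e^{ikx}$, $\widehat f(k)=(2\pi)^{-1}\int_0^{2\pi}f\,\overline{e_k}\,dx$, $k\in\mathbb Z$. For a positive non-increasing $\psi$ on $[1,\infty)$ and $0<q\le\infty$, set $\Psi_0=\psi(1)$, $\Psi_k=\psi(|k|)$ for $k\in\mathbb Z\setminus\{0\}$, and $\mathcal F_q^\psi=\{f\in L_1(\mathbb T^1):\|\{\widehat f(k)/\Psi_k\}_{k\in\mathbb Z}\|_{\ell_q(\mathbb Z)}\le1\}$. $\Gamma_m$ is the set of all collections $\gamma_m$ of $m$ different integers. For a class $\mathfrak N$: $\sigma_m^\perp(\mathfrak N)_{L_p}=\sup_{f\in\mathfrak N}\inf_{\gamma_m\in\Gamma_m}\|f-\sum_{k\in\gamma_m}\widehat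 f(k)e_k\|_{L_p}$; $\mathscr D_m^\perp(\mathfrak N)_{L_p}=\inf_{\gamma_m\in\Gamma_m}\sup_{f\in\mathfrak N}\|f-\sum_{k\in\gamma_m}\widehat f(k)e_k\|_{L_p}$; $G_m(\mathfrak N)_{L_p}=\sup_{f\in\mathfrak N}\inf_{\{k_l(f)\}}\|f-\sum_{l=1}^m\widehat f(k_l(f))e_{k_l(f)}\|_{L_p}$, where the infimum is over all rearrangements $\{k_l(f)\}_{l=1}^\infty$ of $\mathbb Z$ with $|\widehat f(k_1)|\ge|\widehat f(k_2)|\ge\cdots$. $\mathfrak M^c_\infty$ is the set of all positive convex functions $\psi(t)$, $t\ge1$, with $\lim_{t\to\infty}\psi(t)=0$, such that, with $\psi'(t):=\psi'(t+)$, the function $\frac{\psi(t)}{t|\psi'(t)|}$ decreases monotonically to $0$ and $K_4\le\psi(t)/|\psi'(t)|\le K_5$ for all $t\ge1$ with some positive constants $K_4,K_5$. $a(m)\asymp b(m)$ means there are constants $0<K_1<K_2$ independent of $m\in\mathbb N$ with $K_1b(m)\le a(m)\le K_2b(m)$.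
   Formalization: In G_m the rearrangement may leave out integers k with zero Fourier coefficient, since no non-increasing rearrangement of all of ℤ exists when infinitely many coefficients are nonzero and some vanish; where one exists, the greedy sums are the same. *)

theory Defs
  imports "HOL-Analysis.Analysis"
begin

text \<open>Norms take values in \<^typ>\<open>ennreal\<close>, so that the norm of a function outside the space is
  \<open>\<infinity>\<close> and all suprema and infima below are taken in a complete lattice. The following
  power is meant for exponents \<open>r > 0\<close>, with \<open>\<infinity>\<close> raised to \<open>r\<close> being \<open>\<infinity>\<close>.\<close>

definition ennpowr :: "ennreal \<Rightarrow> real \<Rightarrow> ennreal" where
  "ennpowr x r = (if x = \<infinity> then \<infinity> else ennreal (enn2real x powr r))"

text \<open>Functions on the circle are \<open>2\<pi>\<close>-periodic functions on the line; functions that agree almost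
  everywhere are not identified, since everything below depends only on the class of a function.\<close>

definition Lp_norm :: "real \<Rightarrow> (real \<Rightarrow> complex) \<Rightarrow> ennreal" where
  "Lp_norm p f =
     ennpowr ((\<integral>\<^sup>+x\<in>{0..<2*pi}. ennreal (cmod (f x) powr p) \<partial>lebesgue) / ennreal (2*pi)) (1/p)"

definition L1_space :: "(real \<Rightarrow> complex) set" where
  "L1_space = {f. (\<forall>x. f (x + 2*pi) = f x) \<and> set_integrable lebesgue {0..<2*pi} f}"

definition e_fun :: "int \<Rightarrow> real \<Rightarrow> complex" where
  "e_fun k x = exp (\<i> * of_int k * of_real x)"

definition fourier_coeff :: "(real \<Rightarrow> complex) \<Rightarrow> int \<Rightarrow> complex" where
  "fourier_coeff f k = (LINT x:{0..<2*pi}|lebesgue. f x * cnj (e_fun k x)) / of_real (2*pi)"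

definition lq_norm :: "ennreal \<Rightarrow> (int \<Rightarrow> complex) \<Rightarrow> ennreal" where
  "lq_norm q a =
     (if q = \<infinity> then (SUP k. ennreal (cmod (a k)))
      else ennpowr (\<Sum>\<^sub>\<infinity>k. ennreal (cmod (a k) powr enn2real q)) (1 / enn2real q))"

definition Psi :: "(real \<Rightarrow> real) \<Rightarrow> int \<Rightarrow> real" where
  "Psi \<psi> k = (if k = 0 then \<psi> 1 else \<psi> (of_int \<bar>k\<bar>))"

definition F_class :: "ennreal \<Rightarrow> (real \<Rightarrow> real) \<Rightarrow> (real \<Rightarrow> complex) set" where
  "F_class q \<psi> =
     {f \<in> L1_space. lq_norm q (\<lambda>k. fourier_coeff f k / of_real (Psi \<psi> k)) \<le> 1}"

definition Gamma_sets :: "nat \<Rightarrow> int set set" where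
  "Gamma_sets m = {\<gamma>. finite \<gamma> \<and> card \<gamma> = m}"

definition fourier_sum :: "int set \<Rightarrow> (real \<Rightarrow> complex) \<Rightarrow> real \<Rightarrow> complex" where
  "fourier_sum \<gamma> f x = (\<Sum>k\<in>\<gamma>. fourier_coeff f k * e_fun k x)"

definition sigma_perp :: "nat \<Rightarrow> (real \<Rightarrow> complex) set \<Rightarrow> real \<Rightarrow> ennreal" where
  "sigma_perp m N p =
     (SUP f\<in>N. INF \<gamma>\<in>Gamma_sets m. Lp_norm p (\<lambda>x. f x - fourier_sum \<gamma> f x))"

definition D_perp :: "nat \<Rightarrow> (real \<Rightarrow> complex) set \<Rightarrow> real \<Rightarrow> ennreal" where
  "D_perp m N p =
     (INF \<gamma>\<in>Gamma_sets m. SUP f\<in>N. Lp_norm p (\<lambda>x. f x - fourier_sum \<gamma> f x))"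

text \<open>The non-increasing rearrangements of the Fourier coefficients of \<open>f\<close>, indexed from \<open>0\<close>.
  If infinitely many coefficients are nonzero, a sequence with non-increasing moduli
  never reaches a vanishing coefficient, so a bijection onto the integers need not exist; hence only
  indices with a vanishing coefficient may be left out. Whenever a non-increasing bijection
  onto the integers does exist, the possible sets of the first \<open>m\<close> indices are the same as for such
  bijections.\<close>

definition greedy_orders :: "(real \<Rightarrow> complex) \<Rightarrow> (nat \<Rightarrow> int) set" where
  "greedy_orders f =
     {\<kappa>. inj \<kappa> \<and> antimono (\<lambda>l. cmod (fourier_coeff f (\<kappa> l))) \<and>
         (\<forall>j. j \<notin> range \<kappa> \<longrightarrow> fourier_coeff f j = 0)}"

definition G_greedy :: "nat \<Rightarrow> (real \<Rightarrow> complex) set \<Rightarrow> real \<Rightarrow> ennreal" where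
  "G_greedy m N p =
     (SUP f\<in>N. INF \<kappa>\<in>greedy_orders f.
        Lp_norm p (\<lambda>x. f x - (\<Sum>l<m. fourier_coeff f (\<kappa> l) * e_fun (\<kappa> l) x)))"

abbreviation right_deriv :: "(real \<Rightarrow> real) \<Rightarrow> real \<Rightarrow> real" where
  "right_deriv \<psi> t \<equiv> vector_derivative \<psi> (at_right t)"

text \<open>For convex \<open>\<psi>\<close> the right derivative exists automatically at every \<open>t > 1\<close>; requiring it at
  \<open>t = 1\<close> makes the bounds on \<open>\<psi> / \<bar>\<psi>'\<bar>\<close> meaningful there. The lower bound \<open>K4 > 0\<close> excludes
  \<open>\<psi>' = 0\<close>, because division by zero yields zero.\<close>

definition M_c_inf :: "(real \<Rightarrow> real) set" where
  "M_c_inf =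
     {\<psi>. (\<forall>t\<ge>1. \<psi> t > 0) \<and> convex_on {1..} \<psi> \<and> (\<psi> \<longlongrightarrow> 0) at_top \<and>
         (\<forall>t\<ge>1. \<psi> differentiable (at_right t)) \<and>
         antimono_on {1..} (\<lambda>t. \<psi> t / (t * \<bar>right_deriv \<psi> t\<bar>)) \<and>
         ((\<lambda>t. \<psi> t / (t * \<bar>right_deriv \<psi> t\<bar>)) \<longlongrightarrow> 0) at_top \<and>
         (\<exists>K4>0. \<exists>K5>0. \<forall>t\<ge>1. K4 \<le> \<psi> t / \<bar>right_deriv \<psi> t\<bar> \<and> \<psi> t / \<bar>right_deriv \<psi> t\<bar> \<le> K5)}"

definition asymp_order_from :: "nat \<Rightarrow> (nat \<Rightarrow> ennreal) \<Rightarrow> (nat \<Rightarrow> ennreal) \<Rightarrow> bool" where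
  "asymp_order_from m0 a b \<longleftrightarrow>
     (\<exists>K1 K2 :: real. 0 < K1 \<and> K1 < K2 \<and>
        (\<forall>m\<ge>m0. ennreal K1 * b m \<le> a m \<and> a m \<le> ennreal K2 * b m))"

end

theory Submission
  imports Defs
begin

text \<open>
  The bounds on \<open>\<psi> / \<bar>\<psi>'\<bar>\<close> and convexity make \<open>\<psi>\<close> comparable to itself under bounded shifts and
  give geometric decay, so the tail sums of the sequence \<open>\<psi> 1, \<psi> 1, \<psi> 1, \<psi> 2, \<psi> 2, \<dots>\<close> are dominated
  by their first term. Coefficients of functions in the class are bounded by \<open>\<Psi>\<^sub>k\<close>; hence, whether one
  keeps the \<open>m\<close> largest coefficients or \<open>m\<close> frequencies nearest to 0, the Fourier series of the remainder converges
  absolutely and its sup norm is at most a constant times \<open>\<psi> ((m + 1) div 2)\<close>. That an integrable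
  function is a.e. the sum of its absolutely convergent Fourier series is the uniqueness theorem:
  if all coefficients of \<open>f\<close> vanish, then \<open>f\<close> annihilates trigonometric polynomials, which approximate
  the conjugate sign of \<open>f\<close> boundedly a.e. For the lower bound, a multiple \<open>c \<psi> N\<close> of the Dirichlet
  kernel of order \<open>N = (m + 1) div 2\<close> has \<open>2N + 1 > m\<close> equal coefficients, one of which survives
  any choice of \<open>m\<close> frequencies.
\<close>

subsection \<open>Fourier coefficients\<close>

text \<open>Set integrals over a period become plain integrals over a finite measure space. Its mass
  is \<open>2*pi\<close>, so the normalising factor stays explicit.\<close>

abbreviation circle_measure :: "real measure" where
  "circle_measure \<equiv> lebesgue_on {0..<2*pi}"

lemma e_fun_cis: "e_fun k x = cis (of_int k * x)"
  by (simp add: e_fun_def cis_conv_exp mult.assoc)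

lemma norm_e_fun [simp]: "cmod (e_fun k x) = 1"
  by (simp add: e_fun_cis)

lemma continuous_on_e_fun [continuous_intros]: "continuous_on S (e_fun k)"
  unfolding e_fun_def by (intro continuous_intros)

lemma measurable_e_fun [measurable]: "e_fun k \<in> borel_measurable circle_measure"
  by (intro continuous_imp_measurable_on_sets_lebesgue continuous_on_e_fun) auto

lemma cnj_e_fun: "cnj (e_fun k x) = e_fun (- k) x"
  by (simp add: e_fun_cis cis_cnj)

lemma e_fun_mult: "e_fun j x * e_fun k x = e_fun (j + k) x"
  by (simp add: e_fun_cis cis_mult distrib_right)

lemma measurable_cnj_e_fun [measurable]:
  "(\<lambda>x. cnj (e_fun k x)) \<in> borel_measurable circle_measure"
  by (simp add: cnj_e_fun)

lemma finite_measure_circle: "finite_measure circle_measure"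
  by (rule finite_measureI) (simp add: emeasure_restrict_space)

lemma fourier_coeff_circle:
  "fourier_coeff f k = (LINT x|circle_measure. f x * cnj (e_fun k x)) / of_real (2*pi)"
  by (simp add: fourier_coeff_def set_lebesgue_integral_def integral_restrict_space)

lemma L1_space_circle:
  "f \<in> L1_space \<longleftrightarrow> (\<forall>x. f (x + 2*pi) = f x) \<and> integrable circle_measure f"
  by (simp add: L1_space_def set_integrable_def integrable_restrict_space)

lemma Lp_norm_circle:
  "Lp_norm p f =
     ennpowr ((\<integral>\<^sup>+x. ennreal (cmod (f x) powr p) \<partial>circle_measure) / ennreal (2*pi)) (1/p)"
  by (simp add: Lp_norm_def nn_integral_restrict_space)

lemma integrable_mult_bounded:
  fixes f g :: "'a \<Rightarrow> complex"
  assumes "integrable M f" "g \<in> borel_measurable M" "\<And>x. x \<in> space M \<Longrightarrow> cmod (g x) \<le> B"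
  shows "integrable M (\<lambda>x. f x * g x)"
proof (rule Bochner_Integration.integrable_bound)
  show "integrable M (\<lambda>x. B * cmod (f x))"
    using assms by simp
  show "(\<lambda>x. f x * g x) \<in> borel_measurable M"
    using assms by measurable
  show "AE x in M. cmod (f x * g x) \<le> norm (B * cmod (f x))"
  proof (rule AE_I2)
    fix x assume "x \<in> space M"
    then have "cmod (f x) * cmod (g x) \<le> cmod (f x) * B"
      by (intro mult_left_mono assms) auto
    then show "cmod (f x * g x) \<le> norm (B * cmod (f x))"
      by (simp add: norm_mult mult.commute)
  qed
qed

lemma integrable_times_cnj_e_fun:
  "integrable circle_measure f \<Longrightarrow> integrable circle_measure (\<lambda>x. f x * cnj (e_fun k x))"
  by (rule integrable_mult_bounded[where B = 1]) auto

lemma integrable_e_fun: "integrable circle_measure (\<lambda>x. c * e_fun k x)"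
proof -
  interpret finite_measure circle_measure by (rule finite_measure_circle)
  show ?thesis
    by (rule integrable_mult_bounded[where B = 1]) auto
qed

lemma fourier_coeff_add:
  assumes "integrable circle_measure f" "integrable circle_measure g"
  shows "fourier_coeff (\<lambda>x. f x + g x) k = fourier_coeff f k + fourier_coeff g k"
  using assms
  by (simp add: fourier_coeff_circle distrib_right add_divide_distrib integrable_times_cnj_e_fun)

lemma fourier_coeff_diff:
  assumes "integrable circle_measure f" "integrable circle_measure g"
  shows "fourier_coeff (\<lambda>x. f x - g x) k = fourier_coeff f k - fourier_coeff g k"
  using assms
  by (simp add: fourier_coeff_circle left_diff_distrib diff_divide_distrib integrable_times_cnj_e_fun)

lemma fourier_coeff_cmult:
  "fourier_coeff (\<lambda>x. c * f x) k = c * fourier_coeff f k"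
  by (simp add: fourier_coeff_circle mult.assoc)

lemma fourier_coeff_sum:
  assumes "finite A" "\<And>j. j \<in> A \<Longrightarrow> integrable circle_measure (f j)"
  shows "fourier_coeff (\<lambda>x. \<Sum>j\<in>A. f j x) k = (\<Sum>j\<in>A. fourier_coeff (f j) k)"
  using assms
  by (simp add: fourier_coeff_circle sum_distrib_right sum_divide_distrib integrable_times_cnj_e_fun)

text \<open>Orthonormality: for distinct frequencies the product is a nonconstant character, whose
  antiderivative is again \<open>2*pi\<close>-periodic.\<close>

lemma fourier_coeff_e_fun: "fourier_coeff (e_fun j) k = (if j = k then 1 else 0)"
proof -
  have prod: "e_fun j x * cnj (e_fun k x) = cis (of_int (j - k) * x)" for x
    by (simp add: e_fun_cis cis_cnj cis_mult algebra_simps)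
  have "(LINT x|circle_measure. cis (of_int (j - k) * x)) = integral {0..2*pi} (\<lambda>x. cis (of_int (j - k) * x))"
  proof -
    have "integrable circle_measure (\<lambda>x. cis (of_int (j - k) * x))"
      using integrable_e_fun[of 1 "j - k"] by (simp add: e_fun_cis)
    \<comment> \<open>Passing to the gauge integral and adding the negligible endpoint makes the
      fundamental theorem of calculus applicable.\<close>
    then have "(LINT x|circle_measure. cis (of_int (j - k) * x)) = integral {0..<2*pi} (\<lambda>x. cis (of_int (j - k) * x))"
      by (rule lebesgue_integral_eq_integral) auto
    also have "\<dots> = integral {0..2*pi} (\<lambda>x. cis (of_int (j - k) * x))"
      by (rule integral_spike_set; rule negligible_subset[of "{2*pi}"]) auto
    finally show ?thesis .
  qed
  moreover have "integral {0..2*pi} (\<lambda>x. cis (of_int (j - k) * x)) = (if j = k then of_real (2*pi) else 0)"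
  proof (cases "j = k")
    case False
    define n where "n = j - k"
    have n: "n \<noteq> 0" using False by (simp add: n_def)
    have "((\<lambda>x. cis (of_int n * x)) has_integral
       (cis (of_int n * (2*pi)) / (\<i> * of_int n) - cis (of_int n * 0) / (\<i> * of_int n))) {0..2*pi}"
    proof (rule fundamental_theorem_of_calculus)
      fix x :: real
      show "((\<lambda>x. cis (of_int n * x) / (\<i> * of_int n)) has_vector_derivative cis (of_int n * x)) (at x within {0..2*pi})"
        unfolding cis_conv_exp using n
        by (auto intro!: derivative_eq_intros has_vector_derivative_real_field simp: field_simps)
    qed auto
    moreover have "cis (of_int n * (2*pi)) = 1"
      using cis_multiple_2pi[of "of_int n"] by (simp add: mult_ac)
    ultimately show ?thesis using False n_def by (simp add: integral_unique)
  qed (simp add: scaleR_conv_of_real)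
  ultimately show ?thesis
    by (simp add: fourier_coeff_circle prod)
qed

lemma fourier_coeff_const_sum:
  assumes "finite E"
  shows "fourier_coeff (\<lambda>x. \<Sum>k\<in>E. c * e_fun k x) j = (if j \<in> E then c else 0)"
  using assms
  by (simp add: fourier_coeff_sum integrable_e_fun fourier_coeff_cmult fourier_coeff_e_fun
      if_distrib[of "\<lambda>x. _ * x"] cong: if_cong)

subsection \<open>Uniqueness of Fourier coefficients\<close>

text \<open>This is a vector space stable under multiplication by characters; the induction over
  polynomials below never leaves it.\<close>

definition vanishing_coeffs :: "(real \<Rightarrow> complex) set" where
  "vanishing_coeffs = {g. integrable circle_measure g \<and> (\<forall>k. fourier_coeff g k = 0)}"

lemma vanishing_coeffs_add:
  "f \<in> vanishing_coeffs \<Longrightarrow> g \<in> vanishing_coeffs \<Longrightarrow> (\<lambda>x. f x + g x) \<in> vanishing_coeffs"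
  by (simp add: vanishing_coeffs_def fourier_coeff_add)

lemma vanishing_coeffs_cmult:
  "f \<in> vanishing_coeffs \<Longrightarrow> (\<lambda>x. c * f x) \<in> vanishing_coeffs"
  by (simp add: vanishing_coeffs_def fourier_coeff_cmult)

text \<open>Multiplying by \<open>e_fun j\<close> shifts the coefficient sequence by
  \<open>j\<close>.\<close>

lemma vanishing_coeffs_mult_e_fun:
  assumes "f \<in> vanishing_coeffs"
  shows "(\<lambda>x. f x * e_fun j x) \<in> vanishing_coeffs"
proof -
  have "f x * e_fun j x * cnj (e_fun k x) = f x * cnj (e_fun (k - j) x)" for k x
    by (simp add: cnj_e_fun e_fun_mult mult.assoc)
  then have "fourier_coeff (\<lambda>x. f x * e_fun j x) k = fourier_coeff f (k - j)" for k
    by (simp only: fourier_coeff_circle)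
  moreover have "integrable circle_measure (\<lambda>x. f x * e_fun j x)"
    using assms integrable_times_cnj_e_fun[of f "- j"]
    by (simp add: vanishing_coeffs_def cnj_e_fun)
  ultimately show ?thesis
    using assms by (simp add: vanishing_coeffs_def)
qed

text \<open>A polynomial in \<open>cis x\<close> is a trigonometric polynomial, so multiplication by
  it combines shifts of the coefficients linearly.\<close>

lemma vanishing_coeffs_mult_polynomial:
  fixes r :: "complex \<Rightarrow> real"
  assumes "real_polynomial_function r" "f \<in> vanishing_coeffs"
  shows "(\<lambda>x. f x * of_real (r (cis x))) \<in> vanishing_coeffs"
  using assms
proof (induction arbitrary: f rule: real_polynomial_function.induct)
  case (linear r)
  interpret bounded_linear r by fact
  \<comment> \<open>A real-linear functional on the plane is fixed by its values at 1 and
    \<open>\<i>\<close>, which reduces the linear case to cosine and sine, that is, to the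
    characters of frequency 1 and -1.\<close>
  have "r (cis x) = cos x * r 1 + sin x * r \<i>" for x
  proof -
    have "cis x = cos x *\<^sub>R 1 + sin x *\<^sub>R \<i>"
      by (simp add: complex_eq_iff)
    then show ?thesis
      by (metis add scaleR real_scaleR_def)
  qed
  moreover have "of_real (cos x) = (e_fun 1 x + e_fun (-1) x) / 2"
    "of_real (sin x) = (e_fun 1 x - e_fun (-1) x) / (2 * \<i>)" for x
    by (simp_all add: complex_eq_iff e_fun_cis)
  ultimately have r_cis: "of_real (r (cis x)) = (e_fun 1 x + e_fun (-1) x) / 2 * of_real (r 1) +
      (e_fun 1 x - e_fun (-1) x) / (2 * \<i>) * of_real (r \<i>)" for x
    by simp
  have "f x * of_real (r (cis x)) =
      (of_real (r 1) / 2 + of_real (r \<i>) / (2 * \<i>)) * (f x * e_fun 1 x) +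
      (of_real (r 1) / 2 - of_real (r \<i>) / (2 * \<i>)) * (f x * e_fun (-1) x)" for x
    unfolding r_cis by (simp add: algebra_simps add_divide_distrib diff_divide_distrib)
  then show ?case
    using linear.prems
    by (auto intro!: vanishing_coeffs_add vanishing_coeffs_cmult vanishing_coeffs_mult_e_fun)
next
  case (const c)
  then show ?case
    using vanishing_coeffs_cmult[of f "of_real c"] by (simp add: mult.commute)
next
  case (add r s)
  then show ?case
    using vanishing_coeffs_add by (simp add: distrib_left)
next
  case (mult r s)
  \<comment> \<open>The hypothesis for \<open>s\<close> is applied to the function already
    multiplied by \<open>r\<close>; hence the induction over arbitrary \<open>f\<close>.\<close>
  then have "(\<lambda>x. f x * of_real (r (cis x)) * of_real (s (cis x))) \<in> vanishing_coeffs"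
    by blast
  then show ?case by (simp add: mult.assoc)
qed

lemma integral_vanishing_coeffs_mult_polynomial:
  fixes P :: "complex \<Rightarrow> complex"
  assumes "polynomial_function P" "f \<in> vanishing_coeffs"
  shows "integrable circle_measure (\<lambda>x. f x * P (cis x))"
    and "(LINT x|circle_measure. f x * P (cis x)) = 0"
proof -
  have re: "real_polynomial_function (\<lambda>z. Re (P z))" and im: "real_polynomial_function (\<lambda>z. Im (P z))"
    using assms(1) bounded_linear_Re bounded_linear_Im
    unfolding polynomial_function_def o_def by blast+
  have "(\<lambda>x. f x * of_real (Re (P (cis x))) + \<i> * (f x * of_real (Im (P (cis x))))) \<in> vanishing_coeffs"
    using vanishing_coeffs_mult_polynomial[OF re assms(2)] vanishing_coeffs_mult_polynomial[OF im assms(2)]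
    by (intro vanishing_coeffs_add vanishing_coeffs_cmult)
  moreover have "f x * of_real (Re (P (cis x))) + \<i> * (f x * of_real (Im (P (cis x)))) = f x * P (cis x)" for x
    by (subst complex_eq[of "P (cis x)"]) (simp add: algebra_simps)
  ultimately have v: "(\<lambda>x. f x * P (cis x)) \<in> vanishing_coeffs"
    by simp
  then show "integrable circle_measure (\<lambda>x. f x * P (cis x))"
    by (simp add: vanishing_coeffs_def)
  have "fourier_coeff (\<lambda>x. f x * P (cis x)) 0 = 0"
    using v by (simp add: vanishing_coeffs_def)
  then show "(LINT x|circle_measure. f x * P (cis x)) = 0"
    by (simp add: fourier_coeff_circle e_fun_cis)
qed

text \<open>The cutoff \<open>min 1 (real n * cmod (z - 1))\<close> removes the jump of \<^const>\<open>Arg2pi\<close> at 1.\<close>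

lemma continuous_on_circle_cutoff:
  fixes c :: "real \<Rightarrow> complex"
  assumes c: "continuous_on UNIV c" and bound: "\<And>x. cmod (c x) \<le> 1"
  shows "continuous_on (sphere 0 1) (\<lambda>z. c (Arg2pi z) * of_real (min 1 (real n * cmod (z - 1))))"
proof (rule continuous_at_imp_continuous_on, rule ballI)
  fix z :: complex assume z: "z \<in> sphere 0 1"
  let ?F = "\<lambda>z. c (Arg2pi z) * of_real (min 1 (real n * cmod (z - 1)))"
  show "isCont ?F z"
  proof (cases "z = 1")
    case True
    \<comment> \<open>The cutoff makes the value at 1 equal to 0, so it suffices that the limit
      there is 0.\<close>
    have "(?F \<longlongrightarrow> 0) (at 1)"
    proof (rule Lim_null_comparison)
      show "\<forall>\<^sub>F z in at 1. norm (?F z) \<le> real n * cmod (z - 1)"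
      proof (rule always_eventually, rule allI)
        fix z :: complex
        have "norm (?F z) \<le> 1 * (real n * cmod (z - 1))"
          unfolding norm_mult by (intro mult_mono bound) auto
        then show "norm (?F z) \<le> real n * cmod (z - 1)" by simp
      qed
      have "((\<lambda>z. real n * cmod (z - 1)) \<longlongrightarrow> real n * cmod (1 - 1)) (at 1)"
        by (intro tendsto_intros)
      then show "((\<lambda>z. real n * cmod (z - 1)) \<longlongrightarrow> 0) (at 1)" by simp
    qed
    then show ?thesis using True by (simp add: isCont_def)
  next
    case False
    \<comment> \<open>\<open>Arg2pi\<close> is continuous off the nonnegative real axis, which meets
      the unit circle only at 1.\<close>
    have "z \<notin> \<real>\<^sub>\<ge>\<^sub>0"
    proof
      assume "z \<in> \<real>\<^sub>\<ge>\<^sub>0"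
      then obtain r where "z = of_real r" "r \<ge> 0" by (auto elim: nonneg_Reals_cases)
      with z False show False by simp
    qed
    then have "isCont Arg2pi z" by (rule continuous_at_Arg2pi)
    moreover have "isCont c (Arg2pi z)"
      using c by (simp add: continuous_on_eq_continuous_at)
    ultimately have "isCont (\<lambda>z. c (Arg2pi z)) z" by (rule isCont_o2)
    then show ?thesis by (intro continuous_intros)
  qed
qed

lemma AE_circle_0: "AE x in circle_measure. x \<noteq> 0"
proof -
  have "AE x in lebesgue. x \<noteq> (0::real)"
    by (rule AE_I[where N = "{0}"]) auto
  then show ?thesis
    by (subst AE_restrict_space_iff) auto
qed

text \<open>The conjugate sign \<open>u\<close> is approached in stages: continuous
  \<open>c n\<close> on the line, continuous \<open>F n\<close> on the circle, polynomials
  \<open>P n\<close>. All are uniformly bounded on the circle or line, so dominated convergence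
  carries the vanishing integrals of \<open>f x * P n (cis x)\<close> over to
  \<open>cmod (f x)\<close>.\<close>

theorem vanishing_coeffs_AE_zero:
  assumes f: "f \<in> vanishing_coeffs"
  shows "AE x in circle_measure. f x = 0"
proof -
  let ?M = circle_measure
  have int: "integrable ?M f" using f by (simp add: vanishing_coeffs_def)
  \<comment> \<open>Extension by 0 off the period makes \<open>u\<close> measurable on the whole
    line, hence an a.e. limit of continuous functions.\<close>
  define u where "u x = cnj (sgn (indicator {0..<2*pi} x *\<^sub>R f x))" for x
  have "(\<lambda>x. indicator {0..<2*pi} x *\<^sub>R f x) \<in> borel_measurable lebesgue"
    using int by (subst (asm) integrable_restrict_space) auto
  moreover have [measurable]: "cnj \<in> borel_measurable borel"
    by (intro borel_measurable_continuous_onI continuous_intros)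
  ultimately have "u \<in> borel_measurable lebesgue"
    unfolding u_def sgn_div_norm by measurable
  then have "u measurable_on UNIV"
    by (rule lebesgue_measurable_imp_measurable_on) simp
  then obtain N g where N: "negligible N" and g: "\<And>n. continuous_on UNIV (g n)"
    and lim: "\<And>x. x \<notin> N \<Longrightarrow> (\<lambda>n. g n x) \<longlonglongrightarrow> u x"
    unfolding measurable_on_def by auto
  \<comment> \<open>Radial retraction onto the closed unit disc. It fixes the values of
    \<open>u\<close>, so the limit is unchanged while the bound 1 is gained.\<close>
  define c where "c n x = g n x /\<^sub>R max 1 (cmod (g n x))" for n :: nat and x
  have c_cont: "continuous_on UNIV (c n)" for n
    unfolding c_def by (intro continuous_intros g) auto
  have c_le: "cmod (c n x) \<le> 1" for n x
    by (simp add: c_def divide_simps)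
  have c_lim: "(\<lambda>n. c n x) \<longlonglongrightarrow> u x" if "x \<notin> N" for x
  proof -
    have "(\<lambda>n. c n x) \<longlonglongrightarrow> u x /\<^sub>R max 1 (cmod (u x))"
      unfolding c_def by (intro tendsto_intros lim that) auto
    moreover have "max 1 (cmod (u x)) = 1"
      by (simp add: u_def norm_sgn)
    ultimately show ?thesis by simp
  qed
  \<comment> \<open>Each \<open>F n\<close> vanishes at 1, but at any other point of the circle the
    cutoff equals 1 for large \<open>n\<close> and no longer affects the limit.\<close>
  define F where "F n z = c n (Arg2pi z) * of_real (min 1 (real n * cmod (z - 1)))" for n z
  have F_cont: "continuous_on (sphere 0 1) (F n)" for n
    unfolding F_def by (intro continuous_on_circle_cutoff c_cont c_le)
  have F_le: "cmod (F n z) \<le> 1" for n z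
    unfolding F_def norm_mult using c_le[of n] by (intro mult_le_one) auto
  have "\<exists>P. polynomial_function P \<and> (\<forall>z\<in>sphere 0 1. cmod (F n z - P z) < 1 / real (Suc n))" for n
    by (rule Stone_Weierstrass_polynomial_function) (auto intro: F_cont)
  then obtain P where P: "\<And>n. polynomial_function (P n)"
    and P_approx: "\<And>n z. z \<in> sphere 0 1 \<Longrightarrow> cmod (F n z - P n z) < 1 / real (Suc n)"
    by metis
  have P_lim: "(\<lambda>n. P n (cis x)) \<longlonglongrightarrow> u x" if x: "x \<notin> N" "0 < x" "x < 2*pi" for x
  proof -
    have arg: "Arg2pi (cis x) = x"
      using Arg2pi_unique[of 1 x "cis x"] x by (simp add: cis_conv_exp)
    have "cis x \<noteq> 1"
      using arg x Arg2pi_of_real[of 1] by auto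
    then have pos: "cmod (cis x - 1) > 0" by simp
    have "\<forall>\<^sub>F n in sequentially. F n (cis x) = c n x"
    proof -
      have "filterlim (\<lambda>n. real n * cmod (cis x - 1)) at_top sequentially"
        by (rule filterlim_at_top_mult_tendsto_pos[OF tendsto_const pos filterlim_real_sequentially])
      then have "\<forall>\<^sub>F n in sequentially. 1 \<le> real n * cmod (cis x - 1)"
        by (simp add: filterlim_at_top)
      then show ?thesis
        by eventually_elim (simp add: F_def arg)
    qed
    then have F_lim: "(\<lambda>n. F n (cis x)) \<longlonglongrightarrow> u x"
      using c_lim[OF x(1)] by (simp add: tendsto_cong)
    have "(\<lambda>n. F n (cis x) - P n (cis x)) \<longlonglongrightarrow> 0"
    proof (rule Lim_null_comparison)
      show "\<forall>\<^sub>F n in sequentially. cmod (F n (cis x) - P n (cis x)) \<le> 1 / real (Suc n)"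
        using P_approx by (intro always_eventually) (auto intro: less_imp_le)
      show "(\<lambda>n. 1 / real (Suc n)) \<longlonglongrightarrow> 0"
        using LIMSEQ_inverse_real_of_nat by (simp add: inverse_eq_divide)
    qed
    from tendsto_diff[OF F_lim this] show ?thesis by simp
  qed
  have P_le: "cmod (P n (cis x)) \<le> 2" for n x
  proof -
    have "cmod (P n (cis x)) \<le> cmod (F n (cis x)) + cmod (F n (cis x) - P n (cis x))"
      by norm
    also have "\<dots> \<le> 1 + 1"
    proof (intro add_mono F_le)
      have "cmod (F n (cis x) - P n (cis x)) \<le> 1 / real (Suc n)"
        using P_approx[of "cis x" n] by simp
      also have "\<dots> \<le> 1" by simp
      finally show "cmod (F n (cis x) - P n (cis x)) \<le> 1" .
    qed
    finally show ?thesis by simp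
  qed
  have conv: "AE x in ?M. (\<lambda>n. f x * P n (cis x)) \<longlonglongrightarrow> f x * u x"
  proof -
    have "AE x in lebesgue. x \<notin> N"
      using N by (simp add: negligible_iff_null_sets AE_not_in)
    then have "AE x in ?M. x \<notin> N"
      by (subst AE_restrict_space_iff) auto
    then show ?thesis
      using AE_circle_0 AE_space
    proof eventually_elim
      case (elim x)
      then show ?case
        by (intro tendsto_mult_left P_lim) (auto simp: space_restrict_space)
    qed
  qed
  have f_u: "f x * u x = of_real (cmod (f x))" if "x \<in> space ?M" for x
  proof -
    have "f x * u x = (f x * cnj (f x)) / of_real (cmod (f x))"
      using that by (simp add: u_def sgn_eq space_restrict_space)
    also have "\<dots> = of_real (cmod (f x)) * (of_real (cmod (f x)) / of_real (cmod (f x)))"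
      by (simp only: complex_norm_square[symmetric] power2_eq_square of_real_mult times_divide_eq_right)
    also have "\<dots> = of_real (cmod (f x))" by simp
    finally show ?thesis .
  qed
  have meas: "(\<lambda>x. f x * u x) \<in> borel_measurable ?M"
    using int by (subst measurable_cong[OF f_u]) auto
  have "(\<lambda>n. LINT x|?M. f x * P n (cis x)) \<longlonglongrightarrow> (LINT x|?M. f x * u x)"
  proof (rule integral_dominated_convergence[where w = "\<lambda>x. 2 * cmod (f x)"])
    show "integrable ?M (\<lambda>x. 2 * cmod (f x))" using int by simp
    show "AE x in ?M. cmod (f x * P n (cis x)) \<le> 2 * cmod (f x)" for n
    proof (rule AE_I2)
      fix x
      have "cmod (f x) * cmod (P n (cis x)) \<le> cmod (f x) * 2"
        by (intro mult_left_mono P_le) auto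
      then show "cmod (f x * P n (cis x)) \<le> 2 * cmod (f x)"
        by (simp add: norm_mult mult.commute)
    qed
    show "(\<lambda>x. f x * P n (cis x)) \<in> borel_measurable ?M" for n
      using integral_vanishing_coeffs_mult_polynomial(1)[OF P f] by (rule borel_measurable_integrable)
  qed (use meas conv in auto)
  moreover have "(LINT x|?M. f x * P n (cis x)) = 0" for n
    by (rule integral_vanishing_coeffs_mult_polynomial[OF P f])
  ultimately have "(\<lambda>n. 0) \<longlonglongrightarrow> (LINT x|?M. f x * u x)"
    by simp
  then have "(LINT x|?M. f x * u x) = 0"
    by (simp add: LIMSEQ_const_iff)
  moreover have "(LINT x|?M. f x * u x) = (LINT x|?M. complex_of_real (cmod (f x)))"
    by (rule Bochner_Integration.integral_cong[OF refl f_u])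
  ultimately have "(LINT x|?M. cmod (f x)) = 0"
    by simp
  then show ?thesis
    using int by (subst (asm) integral_nonneg_eq_0_iff_AE) auto
qed

subsection \<open>Absolutely convergent Fourier series and \<open>L\<^sub>p\<close> norms\<close>

text \<open>The sum \<open>s\<close> of the series is integrable and may be integrated termwise, so
  it has the coefficients of \<open>f\<close>; the uniqueness theorem applies to the difference.
  Injectivity of \<open>\<kappa>\<close> prevents a frequency from being counted twice.\<close>

lemma fourier_series_AE:
  assumes f: "integrable circle_measure f" and inj: "inj \<kappa>"
    and off: "\<And>j. j \<notin> range \<kappa> \<Longrightarrow> fourier_coeff f j = 0"
    and summ: "summable (\<lambda>l::nat. cmod (fourier_coeff f (\<kappa> l)))"
  shows "AE x in circle_measure. (\<lambda>l. fourier_coeff f (\<kappa> l) * e_fun (\<kappa> l) x) sums f x"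
proof -
  let ?M = circle_measure
  interpret finite_measure ?M by (rule finite_measure_circle)
  define t where "t l x = fourier_coeff f (\<kappa> l) * e_fun (\<kappa> l) x" for l x
  define s where "s x = (\<Sum>l. t l x)" for x
  have t_norm: "cmod (t l x) = cmod (fourier_coeff f (\<kappa> l))" for l x
    by (simp add: t_def norm_mult)
  have t_int: "integrable ?M (t l)" for l
    unfolding t_def by (rule integrable_e_fun)
  have t_summ: "summable (\<lambda>l. cmod (t l x))" for x
    unfolding t_norm by (rule summ)
  then have t_sums: "(\<lambda>l. t l x) sums s x" for x
    unfolding s_def by (rule summable_sums[OF summable_norm_cancel])
  have int_summ: "summable (\<lambda>l. LINT x|?M. cmod (t l x))"
    unfolding t_norm using summ by (simp add: summable_mult)
  have s_int: "integrable ?M s"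
    unfolding s_def by (rule integrable_suminf) (use t_int t_summ int_summ in auto)
  have "fourier_coeff s k = fourier_coeff f k" for k
  proof -
    let ?g = "\<lambda>l x. t l x * cnj (e_fun k x)"
    have "(\<lambda>l. LINT x|?M. ?g l x) sums (LINT x|?M. (\<Sum>l. ?g l x))"
    proof (rule sums_integral)
      show "integrable ?M (?g l)" for l
        by (rule integrable_times_cnj_e_fun[OF t_int])
      show "AE x in ?M. summable (\<lambda>l. cmod (?g l x))"
        using t_summ by (simp add: norm_mult)
      show "summable (\<lambda>l. LINT x|?M. cmod (?g l x))"
        using int_summ by (simp add: norm_mult)
    qed
    moreover have "(\<Sum>l. ?g l x) = s x * cnj (e_fun k x)" for x
      using t_sums[of x] by (intro sums_unique[symmetric] sums_mult2)
    ultimately have "(\<lambda>l. fourier_coeff (t l) k) sums fourier_coeff s k"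
      unfolding fourier_coeff_circle by (intro sums_divide) simp
    \<comment> \<open>By orthonormality at most one term contributes to the coefficient
      \<open>k\<close>, and none does if \<open>k\<close> is not enumerated; then \<open>off\<close>
      supplies the value 0.\<close>
    moreover have "fourier_coeff (t l) k = (if \<kappa> l = k then fourier_coeff f k else 0)" for l
      unfolding t_def fourier_coeff_cmult fourier_coeff_e_fun by auto
    moreover have "(\<lambda>l. if \<kappa> l = k then fourier_coeff f k else 0) sums fourier_coeff f k"
    proof (cases "k \<in> range \<kappa>")
      case True
      then obtain l0 where "k = \<kappa> l0" by auto
      then have "(\<kappa> l = k) = (l = l0)" for l
        using inj by (auto dest: injD)
      then show ?thesis
        using sums_single[of l0 "\<lambda>_. fourier_coeff f k"] by simp
    next
      case False
      then have "\<kappa> l \<noteq> k" for l by auto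
      then show ?thesis using off[OF False] by simp
    qed
    ultimately show ?thesis
      by (simp add: sums_unique2)
  qed
  then have "(\<lambda>x. f x - s x) \<in> vanishing_coeffs"
    using f s_int by (simp add: vanishing_coeffs_def fourier_coeff_diff)
  then have "AE x in ?M. f x - s x = 0"
    by (rule vanishing_coeffs_AE_zero)
  then show ?thesis
    by eventually_elim (use t_sums in \<open>simp add: t_def\<close>)
qed

section \<open>Bounds for the normalised \<open>L_p\<close> norm\<close>

lemma ennpowr_mono: "x \<le> y \<Longrightarrow> 0 \<le> r \<Longrightarrow> ennpowr x r \<le> ennpowr y r"
  by (cases x; cases y) (auto simp: ennpowr_def top_unique intro!: ennreal_leI powr_mono2)

lemma ennpowr_ennreal: "0 \<le> x \<Longrightarrow> ennpowr (ennreal x) r = ennreal (x powr r)"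
  by (simp add: ennpowr_def)

lemma emeasure_circle: "emeasure circle_measure {0..<2*pi} = ennreal (2*pi)"
  by (simp add: emeasure_restrict_space)

text \<open>The norm averages over a period, so the sup bound passes over without any
  constant.\<close>

lemma Lp_norm_le:
  assumes "1 \<le> p" "0 \<le> B" "AE x in circle_measure. cmod (h x) \<le> B"
  shows "Lp_norm p h \<le> ennreal B"
proof -
  have "(\<integral>\<^sup>+x. ennreal (cmod (h x) powr p) \<partial>circle_measure)
      \<le> (\<integral>\<^sup>+x. ennreal (B powr p) \<partial>circle_measure)"
    by (rule nn_integral_mono_AE, use assms(3) in eventually_elim)
      (use assms in \<open>auto intro!: ennreal_leI powr_mono2\<close>)
  also have "\<dots> = ennreal (B powr p * (2*pi))"
    by (simp add: emeasure_circle ennreal_mult)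
  finally have "(\<integral>\<^sup>+x. ennreal (cmod (h x) powr p) \<partial>circle_measure) / ennreal (2*pi)
      \<le> ennreal (B powr p * (2*pi)) / ennreal (2*pi)"
    by (rule divide_right_mono_ennreal)
  also have "\<dots> = ennreal (B powr p)"
    by (subst divide_ennreal) auto
  finally have "Lp_norm p h \<le> ennpowr (ennreal (B powr p)) (1/p)"
    unfolding Lp_norm_circle by (rule ennpowr_mono) (use assms in auto)
  also have "\<dots> = ennreal B"
    using assms by (simp add: ennpowr_ennreal powr_powr)
  finally show ?thesis .
qed

text \<open>Convexity of the power function in tangent form; integrated below, it plays the role of
  Jensen's inequality.\<close>

lemma powr_above_tangent:
  fixes t A p :: real
  assumes "1 \<le> p" "0 < A" "0 \<le> t"
  shows "p * A powr (p - 1) * (t - A) \<le> t powr p - A powr p"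
\<comment> \<open>The convexity argument runs on the open half-line. At 0 the claim reduces to
  \<open>A powr p \<le> p * A powr p\<close>.\<close>
proof (cases "t = 0")
  case True
  have "A powr (p - 1) * A = A powr p"
    using assms powr_add[of A "p - 1" 1] by simp
  then have "p * A powr (p - 1) * A = p * A powr p"
    by (simp add: mult.assoc)
  moreover have "1 * A powr p \<le> p * A powr p"
    using assms by (intro mult_right_mono) auto
  ultimately have "A powr p \<le> p * A powr (p - 1) * A"
    by linarith
  then show ?thesis
    using True by simp
next
  case False
  show ?thesis
    by (rule convex_on_imp_above_tangent[where A = "{0<..}", OF powr_convex])
      (use assms False in \<open>auto intro!: derivative_eq_intros simp: interior_open\<close>)
qed

text \<open>A coefficient is at most the mean of \<open>cmod (h x)\<close>, and this mean is at most
  the \<open>L_p\<close> mean.\<close>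

lemma fourier_coeff_le_Lp_norm:
  assumes p: "1 \<le> p" and h: "integrable circle_measure h"
  shows "ennreal (cmod (fourier_coeff h k)) \<le> Lp_norm p h"
proof -
  let ?M = circle_measure
  interpret finite_measure ?M by (rule finite_measure_circle)
  define A where "A = cmod (fourier_coeff h k)"
  define J where "J = (\<integral>\<^sup>+x. ennreal (cmod (h x) powr p) \<partial>?M)"
  have meas: "measure ?M {0..<2*pi} = 2*pi"
    using emeasure_circle by (simp add: measure_def)
  consider "A = 0" | "J = \<infinity>" | "A > 0" "J < \<infinity>"
    by (cases J) (auto simp: A_def)
  then show ?thesis
  proof cases
    case 1
    then show ?thesis by (simp add: A_def)
  next
    case 2
    then have "Lp_norm p h = \<infinity>"
      by (simp add: Lp_norm_circle J_def ennpowr_def ennreal_top_divide)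
    then show ?thesis by simp
  next
    case 3
    have hp: "integrable ?M (\<lambda>x. cmod (h x) powr p)"
      using h 3(2) by (intro integrableI_bounded) (auto simp: J_def)
    have "2*pi*A = cmod (LINT x|?M. h x * cnj (e_fun k x))"
      by (simp add: A_def fourier_coeff_circle norm_divide norm_mult)
    also have "\<dots> \<le> (LINT x|?M. cmod (h x * cnj (e_fun k x)))"
      by (rule integral_norm_bound)
    also have "\<dots> = (LINT x|?M. cmod (h x))"
      by (simp add: norm_mult)
    finally have mean: "2*pi*A \<le> (LINT x|?M. cmod (h x))" .
    \<comment> \<open>The tangent inequality at height \<open>A\<close> is integrated over the
      circle; its left side is nonnegative because the mean of \<open>cmod (h x)\<close> is at least
      \<open>A\<close>.\<close>
    have "0 \<le> p * A powr (p - 1) * ((LINT x|?M. cmod (h x)) - 2*pi*A)"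
      using mean p by (intro mult_nonneg_nonneg) auto
    also have "\<dots> = (LINT x|?M. p * A powr (p - 1) * (cmod (h x) - A))"
      using h by (simp add: meas)
    also have "\<dots> \<le> (LINT x|?M. cmod (h x) powr p - A powr p)"
      using h hp p 3 by (intro integral_mono powr_above_tangent) auto
    also have "\<dots> = (LINT x|?M. cmod (h x) powr p) - 2*pi * A powr p"
      using hp by (simp add: meas)
    finally have "ennreal (A powr p * (2*pi)) \<le> ennreal (LINT x|?M. cmod (h x) powr p)"
      by (intro ennreal_leI) (simp add: mult_ac)
    also have "\<dots> = J"
      unfolding J_def using hp by (subst nn_integral_eq_integral) auto
    finally have "ennreal (A powr p * (2*pi)) / ennreal (2*pi) \<le> J / ennreal (2*pi)"
      by (rule divide_right_mono_ennreal)
    moreover have "ennreal (A powr p * (2*pi)) / ennreal (2*pi) = ennreal (A powr p)"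
      by (subst divide_ennreal) auto
    ultimately have "ennpowr (ennreal (A powr p)) (1/p) \<le> Lp_norm p h"
      unfolding Lp_norm_circle J_def using p by (intro ennpowr_mono) auto
    then show ?thesis
      using p 3 by (simp add: ennpowr_ennreal powr_powr flip: A_def)
  qed
qed

text \<open>Almost everywhere the remainder is the tail of an absolutely convergent series, so a
  majorant \<open>b\<close> of the coefficients bounds it independently of \<open>p\<close>.\<close>

lemma Lp_norm_remainder_le:
  assumes p: "1 \<le> p" and f: "integrable circle_measure f" and inj: "inj \<kappa>"
    and off: "\<And>j. j \<notin> range \<kappa> \<Longrightarrow> fourier_coeff f j = 0"
    and b: "summable b" "\<And>l::nat. cmod (fourier_coeff f (\<kappa> l)) \<le> b l"
  shows "Lp_norm p (\<lambda>x. f x - (\<Sum>l<m. fourier_coeff f (\<kappa> l) * e_fun (\<kappa> l) x))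
    \<le> ennreal (\<Sum>j. b (j + m))"
proof (rule Lp_norm_le[OF p])
  have b0: "0 \<le> b l" for l using b(2)[of l] norm_ge_zero order_trans by blast
  show "0 \<le> (\<Sum>j. b (j + m))"
    using b(1) b0 by (intro suminf_nonneg) (simp_all add: summable_iff_shift)
  have "summable (\<lambda>l. cmod (fourier_coeff f (\<kappa> l)))"
    by (rule summable_comparison_test'[OF b(1)]) (use b(2) in auto)
  then have "AE x in circle_measure. (\<lambda>l. fourier_coeff f (\<kappa> l) * e_fun (\<kappa> l) x) sums f x"
    using fourier_series_AE f inj off by blast
  then show "AE x in circle_measure.
      cmod (f x - (\<Sum>l<m. fourier_coeff f (\<kappa> l) * e_fun (\<kappa> l) x)) \<le> (\<Sum>j. b (j + m))"
  proof eventually_elim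
    case (elim x)
    let ?t = "\<lambda>l. fourier_coeff f (\<kappa> l) * e_fun (\<kappa> l) x"
    have le: "cmod (?t (j + m)) \<le> b (j + m)" for j
      using b(2) by (simp add: norm_mult)
    have "f x - (\<Sum>l<m. ?t l) = (\<Sum>j. ?t (j + m))"
      by (rule sums_unique[OF sums_split_initial_segment[OF elim]])
    also have "cmod \<dots> \<le> (\<Sum>j. b (j + m))"
      using b(1) le by (intro norm_suminf_le) (auto simp: summable_iff_shift)
    finally show ?case .
  qed
qed

section \<open>Enumeration in non-increasing order and a counting bound\<close>

lemma exists_nonincreasing_enumeration:
  fixes c :: "'a \<Rightarrow> real"
  assumes inf: "infinite (UNIV :: 'a set)" and nonneg: "\<And>k. 0 \<le> c k"
    and fin: "\<And>\<epsilon>. 0 < \<epsilon> \<Longrightarrow> finite {k. \<epsilon> \<le> c k}"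
  shows "\<exists>\<kappa>::nat \<Rightarrow> 'a. inj \<kappa> \<and> antimono (\<lambda>l. c (\<kappa> l)) \<and> (\<forall>j. j \<notin> range \<kappa> \<longrightarrow> c j = 0)"
proof -
  have ex: "\<exists>k. k \<notin> A \<and> (\<forall>j. j \<notin> A \<longrightarrow> c j \<le> c k)" if "finite A" for A
  proof (cases "\<exists>k. k \<notin> A \<and> 0 < c k")
    case True
    then obtain k0 where k0: "k0 \<notin> A" "0 < c k0" by auto
    \<comment> \<open>A maximum over this finite set is a maximum over the whole complement of
      \<open>A\<close>, as all other values there lie below \<open>c k0\<close>.\<close>
    let ?B = "{k. c k0 \<le> c k} - A"
    have B: "finite ?B" "?B \<noteq> {}" using fin[OF k0(2)] k0 by auto
    then have "Max (c ` ?B) \<in> c ` ?B" by (intro Max_in) auto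
    then obtain k where "k \<in> ?B" "Max (c ` ?B) = c k" by auto
    then have k: "k \<in> ?B" "\<And>j. j \<in> ?B \<Longrightarrow> c j \<le> c k"
      using Max_ge[OF finite_imageI[OF B(1)], of _ c] by auto
    have "c j \<le> c k" if "j \<notin> A" for j
      using k(1) k(2)[of j] that by (cases "c k0 \<le> c j") auto
    with k(1) show ?thesis by blast
  next
    case False
    obtain k where "k \<notin> A" using inf \<open>finite A\<close> ex_new_if_finite by blast
    moreover have "c j \<le> c k" if "j \<notin> A" for j
      using False nonneg that by (meson not_less order_trans)
    ultimately show ?thesis by blast
  qed
  define pick where "pick A = (SOME k. k \<notin> A \<and> (\<forall>j. j \<notin> A \<longrightarrow> c j \<le> c k))" for A
  \<comment> \<open>The recursion carries the set of all indices picked so far, since each pick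
    depends on all earlier ones.\<close>
  define A where "A = rec_nat {} (\<lambda>_ S. insert (pick S) S)"
  have A_Suc: "A 0 = {}" "A (Suc n) = insert (pick (A n)) (A n)" for n
    by (simp_all add: A_def)
  define \<kappa> where "\<kappa> n = pick (A n)" for n
  have A_eq: "A n = \<kappa> ` {..<n}" for n
    by (induction n) (simp_all add: A_Suc \<kappa>_def lessThan_Suc)
  have pick: "\<kappa> n \<notin> \<kappa> ` {..<n}" "\<And>j. j \<notin> \<kappa> ` {..<n} \<Longrightarrow> c j \<le> c (\<kappa> n)" for n
    using someI_ex[OF ex[of "A n"]] by (auto simp: A_eq \<kappa>_def[of n] pick_def)
  show ?thesis
  proof (intro exI[of _ \<kappa>] conjI allI impI)
    show inj: "inj \<kappa>"
    proof (rule linorder_injI)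
      fix i j :: nat assume "i < j"
      then show "\<kappa> i \<noteq> \<kappa> j" using pick(1)[of j] by (metis imageI lessThan_iff)
    qed
    show "antimono (\<lambda>l. c (\<kappa> l))"
    proof (rule antimonoI)
      fix i j :: nat assume "i \<le> j"
      then show "c (\<kappa> j) \<le> c (\<kappa> i)"
        using inj by (intro pick(2)) (auto simp: inj_eq)
    qed
    show "c j = 0" if j: "j \<notin> range \<kappa>" for j
    proof (rule ccontr)
      assume "c j \<noteq> 0"
      \<comment> \<open>A positive value never picked would be at most every picked one, forcing
        infinitely many picks into a finite superlevel set.\<close>
      then have "finite {k. c j \<le> c k}" using fin nonneg by (metis order_le_less)
      moreover have "range \<kappa> \<subseteq> {k. c j \<le> c k}" using pick(2) j by blast
      ultimately show False using inj finite_subset range_inj_infinite by blast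
    qed
  qed
qed

text \<open>Pigeonhole: with N = \<open>(l + 1) div 2\<close>, at most \<open>l\<close> integers
  have absolute value below N, while \<open>l + 1\<close> distinct values are taken.\<close>

lemma inj_int_abs_ge:
  assumes "inj (\<kappa> :: nat \<Rightarrow> int)"
  obtains j where "j \<le> l" "int ((l + 1) div 2) \<le> \<bar>\<kappa> j\<bar>"
proof (rule ccontr)
  assume "\<not> thesis"
  then have "\<kappa> ` {..l} \<subseteq> {- int ((l + 1) div 2) + 1..int ((l + 1) div 2) - 1}"
    using that by (force simp: not_le)
  then have "card (\<kappa> ` {..l}) \<le> card {- int ((l + 1) div 2) + 1..int ((l + 1) div 2) - 1}"
    by (intro card_mono) auto
  moreover have "card (\<kappa> ` {..l}) = l + 1"
    using assms by (simp add: card_image inj_on_subset)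
  ultimately show False by simp
qed

subsection \<open>The class \<open>M\<^sub>\<infinity>\<^sup>c\<close>\<close>

text \<open>Chord slopes of a convex function increase, so the right derivative is a subgradient,
  also at the left endpoint \<open>a\<close>.\<close>

lemma convex_on_above_right_tangent:
  fixes \<psi> :: "real \<Rightarrow> real"
  assumes conv: "convex_on {a..} \<psi>" and D: "(\<psi> has_real_derivative D) (at_right x)"
    and xy: "a \<le> x" "a \<le> y"
  shows "\<psi> x + D * (y - x) \<le> \<psi> y"
proof -
  have lim: "((\<lambda>t. (\<psi> t - \<psi> x) / (t - x)) \<longlongrightarrow> D) (at_right x)"
    using D by (simp add: has_field_derivative_iff)
  consider "x < y" | "y < x" | "x = y" by linarith
  then show ?thesis
  proof cases
    case 1
    have "\<forall>\<^sub>F t in at_right x. (\<psi> t - \<psi> x) / (t - x) \<le> (\<psi> y - \<psi> x) / (y - x)"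
      using eventually_at_right_real[OF 1]
    proof eventually_elim
      case (elim t)
      then have "(\<psi> x - \<psi> t) / (x - t) \<le> (\<psi> x - \<psi> y) / (x - y)"
        using conv xy by (intro convex_on_slope_le) auto
      then show ?case by (metis minus_diff_eq minus_divide_divide)
    qed
    then have "D \<le> (\<psi> y - \<psi> x) / (y - x)"
      using lim by (intro tendsto_upperbound) auto
    with 1 show ?thesis by (simp add: field_simps)
  next
    case 2
    have "\<forall>\<^sub>F t in at_right x. (\<psi> y - \<psi> x) / (y - x) \<le> (\<psi> t - \<psi> x) / (t - x)"
      using eventually_at_right_real[of x "x + 1"]
    proof (rule eventually_mono)
      fix t assume t: "t \<in> {x<..<x + 1}"
      then have "(\<psi> y - \<psi> x) / (y - x) \<le> (\<psi> y - \<psi> t) / (y - t)"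
        using conv xy 2 by (intro convex_on_slope_le(1)) auto
      also have "\<dots> \<le> (\<psi> x - \<psi> t) / (x - t)"
        using conv xy 2 t by (intro convex_on_slope_le(2)) auto
      also have "\<dots> = (\<psi> t - \<psi> x) / (t - x)"
        by (metis minus_diff_eq minus_divide_divide)
      finally show "(\<psi> y - \<psi> x) / (y - x) \<le> (\<psi> t - \<psi> x) / (t - x)" .
    qed simp
    then have "(\<psi> y - \<psi> x) / (y - x) \<le> D"
      using lim by (intro tendsto_lowerbound) auto
    with 2 show ?thesis by (simp add: field_simps)
  qed simp
qed

context
  fixes \<psi> :: "real \<Rightarrow> real"
  assumes \<psi>: "\<psi> \<in> M_c_inf"
begin

lemma psi_pos: "1 \<le> t \<Longrightarrow> 0 < \<psi> t"
  using \<psi> by (simp add: M_c_inf_def)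

lemma psi_tendsto_0: "(\<psi> \<longlongrightarrow> 0) at_top"
  using \<psi> by (simp add: M_c_inf_def)

lemma psi_above_right_tangent:
  assumes "1 \<le> s" "1 \<le> t"
  shows "\<psi> t + right_deriv \<psi> t * (s - t) \<le> \<psi> s"
proof (rule convex_on_above_right_tangent)
  show "convex_on {1..} \<psi>" using \<psi> by (simp add: M_c_inf_def)
  show "(\<psi> has_real_derivative right_deriv \<psi> t) (at_right t)"
    using \<psi> assms
    by (simp add: M_c_inf_def has_real_derivative_iff_has_vector_derivative flip: vector_derivative_works)
qed (use assms in auto)

text \<open>Once the right derivative is known to be negative, the bounds on the quotient can be
  cleared of the absolute value and the division.\<close>

lemma psi_logarithmic_derivative_bounds:
  obtains K4 K5 where "0 < K4" "0 < K5"
    "\<And>t. 1 \<le> t \<Longrightarrow> right_deriv \<psi> t < 0"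
    "\<And>t. 1 \<le> t \<Longrightarrow> K4 * (- right_deriv \<psi> t) \<le> \<psi> t"
    "\<And>t. 1 \<le> t \<Longrightarrow> \<psi> t \<le> K5 * (- right_deriv \<psi> t)"
proof -
  obtain K4 K5 where K: "0 < K4" "0 < K5" and
    bd: "\<And>t. 1 \<le> t \<Longrightarrow> K4 \<le> \<psi> t / \<bar>right_deriv \<psi> t\<bar> \<and> \<psi> t / \<bar>right_deriv \<psi> t\<bar> \<le> K5"
    using \<psi> unfolding M_c_inf_def by blast
  have neg: "right_deriv \<psi> t < 0" if t: "1 \<le> t" for t
  proof (rule ccontr)
    assume "\<not> ?thesis"
    \<comment> \<open>A nonnegative slope at \<open>t\<close> would keep \<open>\<psi>\<close> above
      \<open>\<psi> t\<close> from there on, against its limit 0.\<close>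
    then have "\<psi> t \<le> \<psi> s" if "t \<le> s" for s
      using psi_above_right_tangent[of s t] t that
      by (smt (verit) mult_nonneg_nonneg)
    then have "\<psi> t \<le> 0"
      by (intro tendsto_lowerbound[OF psi_tendsto_0] eventually_at_top_linorderI[of t]) auto
    with psi_pos[OF t] show False by simp
  qed
  show thesis
  proof
    show "K4 * (- right_deriv \<psi> t) \<le> \<psi> t" "\<psi> t \<le> K5 * (- right_deriv \<psi> t)" if "1 \<le> t" for t
      using bd[OF that] neg[OF that] by (simp_all add: field_simps)
  qed (use K neg in auto)
qed

lemma psi_antimono: "1 \<le> s \<Longrightarrow> s \<le> t \<Longrightarrow> \<psi> t \<le> \<psi> s"
proof -
  obtain K4 K5 where "\<And>t. 1 \<le> t \<Longrightarrow> right_deriv \<psi> t < 0"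
    using psi_logarithmic_derivative_bounds by metis
  moreover assume "1 \<le> s" "s \<le> t"
  ultimately have "0 \<le> right_deriv \<psi> t * (s - t)"
    by (intro mult_nonpos_nonpos) (auto intro: less_imp_le)
  with \<open>1 \<le> s\<close> \<open>s \<le> t\<close> psi_above_right_tangent[of s t] show ?thesis by simp
qed

text \<open>The tangent at \<open>t + 1\<close>, read off at \<open>t\<close>, gives
  \<open>\<psi> t \<ge> (1 + 1 / K5) * \<psi> (t + 1)\<close>.\<close>

lemma psi_geometric_decay:
  obtains \<theta> where "0 < \<theta>" "\<theta> < 1" "\<And>t. 1 \<le> t \<Longrightarrow> \<psi> (t + 1) \<le> \<theta> * \<psi> t"
proof -
  obtain K4 K5 where K: "0 < K5" "\<And>t. 1 \<le> t \<Longrightarrow> \<psi> t \<le> K5 * (- right_deriv \<psi> t)"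
    using psi_logarithmic_derivative_bounds by metis
  have "\<psi> (t + 1) \<le> K5 / (K5 + 1) * \<psi> t" if "1 \<le> t" for t
  proof -
    have "K5 * \<psi> (t + 1) + \<psi> (t + 1) \<le> K5 * (\<psi> (t + 1) + right_deriv \<psi> (t + 1) * (t - (t + 1)))"
      using K(2)[of "t + 1"] that by (simp add: algebra_simps)
    also have "\<dots> \<le> K5 * \<psi> t"
      using psi_above_right_tangent[of t "t + 1"] that K(1) by (intro mult_left_mono) auto
    finally show ?thesis using K(1) by (simp add: field_simps)
  qed
  with K(1) that[of "K5 / (K5 + 1)"] show thesis by simp
qed

text \<open>The tangent at \<open>t\<close> shows that a step of length at most
  \<open>K4 / 2\<close> loses at most half of \<open>\<psi> t\<close>. A unit step may be too long
  for this, so it is split into \<open>n\<close> steps of length \<open>1 / n\<close>, giving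
  \<open>2 ^ n\<close>.\<close>

lemma psi_shift_bound:
  obtains C where "1 \<le> C" "\<And>t. 1 \<le> t \<Longrightarrow> \<psi> t \<le> C * \<psi> (t + 1)"
proof -
  obtain K4 K5 where K: "0 < K4" "\<And>t. 1 \<le> t \<Longrightarrow> K4 * (- right_deriv \<psi> t) \<le> \<psi> t"
    using psi_logarithmic_derivative_bounds by metis
  obtain n :: nat where n: "2 / K4 < real n"
    using reals_Archimedean2 by blast
  then have n0: "0 < n"
    using K(1) by (metis divide_pos_pos gr0I less_trans of_nat_0 zero_less_numeral less_irrefl)
  have half: "\<psi> t \<le> 2 * \<psi> (t + 1 / n)" if "1 \<le> t" for t
  proof -
    have "2 * (1 / n) \<le> K4"
      using n n0 K(1) by (simp add: field_simps)
    have pos: "0 \<le> - right_deriv \<psi> t"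
      using psi_logarithmic_derivative_bounds that by (metis less_imp_le neg_0_le_iff_le)
    have "2 * (1 / n) * (- right_deriv \<psi> t) \<le> \<psi> t"
      using mult_right_mono[OF \<open>2 * (1 / n) \<le> K4\<close> pos] K(2)[OF that] by linarith
    moreover have "\<psi> t + right_deriv \<psi> t * (t + 1 / n - t) \<le> \<psi> (t + 1 / n)"
      using that by (intro psi_above_right_tangent) (simp_all add: add_increasing2)
    ultimately show ?thesis by (simp add: field_simps)
  qed
  have iter: "\<psi> t \<le> 2 ^ j * \<psi> (t + real j / n)" if "1 \<le> t" for t and j :: nat
  proof (induction j)
    case (Suc j)
    have "\<psi> (t + real j / n) \<le> 2 * \<psi> (t + real j / n + 1 / n)"
      using that by (intro half) (simp add: add_increasing2)
    moreover have "t + real j / n + 1 / n = t + real (Suc j) / n"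
      by (simp add: add_divide_distrib)
    ultimately have "2 ^ j * \<psi> (t + real j / n) \<le> 2 ^ j * (2 * \<psi> (t + real (Suc j) / n))"
      by (intro mult_left_mono) auto
    from order_trans[OF Suc this] show ?case by (simp add: mult_ac)
  qed simp
  show thesis
  proof
    show "1 \<le> (2::real) ^ n" by simp
    show "\<psi> t \<le> 2 ^ n * \<psi> (t + 1)" if "1 \<le> t" for t
      using iter[OF that, of n] n0 by simp
  qed
qed

section \<open>The weights and their rearrangement\<close>

lemma Psi_eq: "Psi \<psi> k = \<psi> (max 1 (of_int \<bar>k\<bar>))"
proof (cases "k = 0")
  case False
  then have "1 \<le> real_of_int \<bar>k\<bar>" by linarith
  then show ?thesis using False by (simp add: Psi_def)
qed (simp add: Psi_def)

lemma Psi_pos: "0 < Psi \<psi> k"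
  unfolding Psi_eq by (rule psi_pos) simp

lemma finite_Psi_ge:
  assumes "0 < \<epsilon>"
  shows "finite {k. \<epsilon> \<le> Psi \<psi> k}"
proof -
  obtain T where T: "\<And>t. T \<le> t \<Longrightarrow> \<psi> t < \<epsilon>"
    using order_tendstoD(2)[OF psi_tendsto_0 assms] by (auto simp: eventually_at_top_linorder)
  have "{k. \<epsilon> \<le> Psi \<psi> k} \<subseteq> {- \<lceil>T\<rceil>..\<lceil>T\<rceil>}"
  proof
    fix k assume "k \<in> {k. \<epsilon> \<le> Psi \<psi> k}"
    then have "\<not> T \<le> max 1 (of_int \<bar>k\<bar>)"
      using T unfolding Psi_eq by (metis mem_Collect_eq not_le)
    then have "of_int \<bar>k\<bar> < T" by simp
    then have "\<bar>k\<bar> \<le> \<lceil>T\<rceil>" by linarith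
    then show "k \<in> {- \<lceil>T\<rceil>..\<lceil>T\<rceil>}" by auto
  qed
  then show ?thesis by (rule finite_subset) simp
qed

text \<open>The rearrangement of \<^term>\<open>Psi \<psi>\<close> into a non-increasing sequence indexed from 0.\<close>

definition psi_star :: "nat \<Rightarrow> real" where
  "psi_star l = \<psi> (max 1 (real ((l + 1) div 2)))"

lemma psi_star_eq: "1 \<le> m \<Longrightarrow> psi_star m = \<psi> (real ((m + 1) div 2))"
  by (simp add: psi_star_def)

lemma psi_star_nonneg: "0 \<le> psi_star l"
  unfolding psi_star_def by (rule less_imp_le, rule psi_pos) simp

text \<open>Among the first \<open>l + 1\<close> indices one is far from 0, and its small weight
  bounds all later values. This serves both for \<open>c\<close> the coefficient moduli and for
  \<open>c\<close> the weights themselves.\<close>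

lemma le_psi_star:
  assumes "inj \<kappa>" "antimono (\<lambda>l. c (\<kappa> l))" "\<And>k. c k \<le> Psi \<psi> k"
  shows "c (\<kappa> l) \<le> psi_star l"
proof -
  obtain j where j: "j \<le> l" "int ((l + 1) div 2) \<le> \<bar>\<kappa> j\<bar>"
    using inj_int_abs_ge[OF assms(1)] by metis
  have "c (\<kappa> l) \<le> c (\<kappa> j)" using assms(2) j(1) by (rule antimonoD)
  also have "\<dots> \<le> Psi \<psi> (\<kappa> j)" by (rule assms(3))
  also have "\<dots> \<le> psi_star l"
    unfolding Psi_eq psi_star_def using j(2) by (intro psi_antimono) linarith+
  finally show ?thesis .
qed

lemma psi_star_tail:
  obtains C where "0 < C" "summable psi_star"
    "\<And>m. 1 \<le> m \<Longrightarrow> (\<Sum>j. psi_star (j + m)) \<le> C * psi_star m"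
proof -
  obtain \<theta> where \<theta>: "0 < \<theta>" "\<theta> < 1" "\<And>t. 1 \<le> t \<Longrightarrow> \<psi> (t + 1) \<le> \<theta> * \<psi> t"
    using psi_geometric_decay by metis
  \<comment> \<open>From index 1 on, two index steps advance the argument of \<open>\<psi>\<close>
    by one and gain a factor \<open>\<theta>\<close>, so one step gains \<open>sqrt \<theta>\<close>
    on average. The extra \<open>1 / \<rho>\<close> below covers a single step without
    decay.\<close>
  define \<rho> where "\<rho> = sqrt \<theta>"
  have \<rho>: "0 < \<rho>" "\<rho> < 1" "\<rho> * \<rho> = \<theta>" using \<theta> by (auto simp: \<rho>_def)
  have geom: "psi_star (j + m) \<le> \<rho> ^ j * (psi_star m / \<rho>)" if m: "1 \<le> m" for j m
  proof (induction j rule: induct_nat_012)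
    case 0
    have "psi_star m * \<rho> \<le> psi_star m * 1"
      using \<rho> psi_star_nonneg by (intro mult_left_mono) auto
    then show ?case using \<rho> by (simp add: field_simps)
  next
    case 1
    have "psi_star (1 + m) \<le> psi_star m"
      unfolding psi_star_def by (intro psi_antimono) (auto simp: div_le_mono)
    then show ?case using \<rho> by simp
  next
    case (ge2 j)
    \<comment> \<open>Starting at \<open>m = 0\<close> would fail here: the indices 0, 1 and 2 all
      carry the value \<open>\<psi> 1\<close>.\<close>
    have "1 \<le> (j + m + 1) div 2" using m by simp
    then have "1 \<le> real ((j + m + 1) div 2)" by linarith
    moreover have "(Suc (Suc j) + m + 1) div 2 = (j + m + 1) div 2 + 1" by simp
    ultimately have "psi_star (Suc (Suc j) + m) \<le> \<theta> * psi_star (j + m)"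
      unfolding psi_star_def using \<theta>(3)[of "real ((j + m + 1) div 2)"]
      by (simp add: max_def add.commute)
    also have "\<dots> \<le> \<theta> * (\<rho> ^ j * (psi_star m / \<rho>))"
      using ge2 \<theta> by (intro mult_left_mono) auto
    finally show ?case
      using \<rho>(1) unfolding \<rho>(3)[symmetric] by (simp add: mult_ac)
  qed
  have geom_summ: "summable (\<lambda>j. \<rho> ^ j * (psi_star m / \<rho>))" for m
    using \<rho> by (intro summable_mult2 summable_geometric) auto
  have summ: "summable (\<lambda>j. psi_star (j + m))" if "1 \<le> m" for m
    by (rule summable_comparison_test'[OF geom_summ]) (use geom[OF that] psi_star_nonneg in auto)
  show thesis
  proof
    show "0 < 1 / (\<rho> * (1 - \<rho>))" using \<rho> by simp
    show "summable psi_star" using summ[of 1] by (simp add: summable_Suc_iff)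
    show "(\<Sum>j. psi_star (j + m)) \<le> 1 / (\<rho> * (1 - \<rho>)) * psi_star m" if m: "1 \<le> m" for m
    proof -
      have "(\<Sum>j. psi_star (j + m)) \<le> (\<Sum>j. \<rho> ^ j * (psi_star m / \<rho>))"
        by (intro suminf_le geom summ geom_summ m)
      also have "\<dots> = (\<Sum>j. \<rho> ^ j) * (psi_star m / \<rho>)"
        using \<rho> by (intro suminf_mult2[symmetric] summable_geometric) auto
      also have "\<dots> = 1 / (\<rho> * (1 - \<rho>)) * psi_star m"
        using \<rho> by (simp add: suminf_geometric)
      finally show ?thesis .
    qed
  qed
qed

end

section \<open>Unit balls of the sequence norms\<close>

text \<open>A single term is at most the whole sum, so every class lies in the one for
  \<open>q = \<infinity>\<close>; the upper bounds thereby become independent of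
  \<open>q\<close>.\<close>

lemma lq_norm_le_1D:
  assumes q: "0 < q" and "lq_norm q a \<le> 1"
  shows "cmod (a k) \<le> 1"
proof (cases "q = \<infinity>")
  case True
  have "ennreal (cmod (a k)) \<le> (SUP k. ennreal (cmod (a k)))"
    by (rule SUP_upper) simp
  also have "\<dots> \<le> 1" using assms True by (simp add: lq_norm_def)
  finally show ?thesis by simp
next
  case False
  define r where "r = enn2real q"
  have r: "0 < r" using q False by (simp add: r_def enn2real_positive_iff less_top)
  let ?S = "\<Sum>\<^sub>\<infinity>k. ennreal (cmod (a k) powr r)"
  have "ennreal (cmod (a k) powr r) \<le> ?S"
  proof -
    have "(\<Sum>\<^sub>\<infinity>k\<in>{k}. ennreal (cmod (a k) powr r)) \<le> ?S"
      by (rule infsum_mono_neutral) (auto intro: nonneg_summable_on_complete)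
    then show ?thesis by simp
  qed
  then have "ennpowr (ennreal (cmod (a k) powr r)) (1 / r) \<le> ennpowr ?S (1 / r)"
    using r by (intro ennpowr_mono) auto
  also have "\<dots> \<le> 1"
    using assms False by (simp add: lq_norm_def r_def)
  finally show ?thesis
    using r by (simp add: ennpowr_ennreal powr_powr)
qed

lemma lq_norm_le_1I:
  assumes q: "0 < q" "q \<noteq> \<infinity>" and E: "finite E" "\<And>k. k \<notin> E \<Longrightarrow> a k = 0"
    and "(\<Sum>k\<in>E. cmod (a k) powr enn2real q) \<le> 1"
  shows "lq_norm q a \<le> 1"
proof -
  let ?r = "enn2real q"
  have r: "0 < ?r" using q by (simp add: enn2real_positive_iff less_top)
  have "(\<Sum>\<^sub>\<infinity>k. ennreal (cmod (a k) powr ?r)) = (\<Sum>\<^sub>\<infinity>k\<in>E. ennreal (cmod (a k) powr ?r))"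
    by (rule infsum_cong_neutral) (use E in auto)
  also have "\<dots> = ennreal (\<Sum>k\<in>E. cmod (a k) powr ?r)"
    using E by simp
  also have "\<dots> \<le> ennreal 1"
    using assms by (intro ennreal_leI)
  finally have "ennpowr (\<Sum>\<^sub>\<infinity>k. ennreal (cmod (a k) powr ?r)) (1 / ?r) \<le> ennpowr (ennreal 1) (1 / ?r)"
    using r by (intro ennpowr_mono) auto
  then show ?thesis
    using q by (simp add: lq_norm_def ennpowr_ennreal flip: ennreal_1)
qed

subsection \<open>Approximation of the classes\<close>

lemma F_class_integrable: "f \<in> F_class q \<psi> \<Longrightarrow> integrable circle_measure f"
  by (simp add: F_class_def L1_space_circle)

context
  fixes \<psi> :: "real \<Rightarrow> real" and q :: ennreal
  assumes \<psi>: "\<psi> \<in> M_c_inf" and q: "0 < q"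
begin

lemma F_class_coeff_le:
  assumes "f \<in> F_class q \<psi>"
  shows "cmod (fourier_coeff f k) \<le> Psi \<psi> k"
proof -
  have "cmod (fourier_coeff f k / of_real (Psi \<psi> k)) \<le> 1"
    using assms lq_norm_le_1D[OF q, of "\<lambda>k. fourier_coeff f k / of_real (Psi \<psi> k)" k]
    by (simp add: F_class_def)
  then show ?thesis
    using Psi_pos[OF \<psi>, of k] by (simp add: norm_divide divide_simps)
qed

text \<open>The point is that \<open>c\<close> does not depend on \<open>N\<close>: the powers of
  \<open>\<psi> N / Psi \<psi> k\<close> decay geometrically away from the ends of the block, so
  their sum is bounded uniformly.\<close>

lemma F_class_trig_poly:
  obtains c where "0 < c" "\<And>N::nat. 1 \<le> N \<Longrightarrow>
    (\<lambda>x. \<Sum>k\<in>{- int N..int N}. of_real (c * \<psi> N) * e_fun k x) \<in> F_class q \<psi>"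
proof -
  let ?E = "\<lambda>N::nat. {- int N..int N}"
  have L1: "(\<lambda>x. \<Sum>k\<in>?E N. of_real a * e_fun k x) \<in> L1_space" for a N
  proof -
    have "e_fun k (x + 2*pi) = e_fun k x" for k x
      using cis_multiple_2pi[of "of_int k"]
      by (simp add: e_fun_cis distrib_left mult_ac flip: cis_mult)
    then show ?thesis
      unfolding L1_space_circle by (simp add: integrable_e_fun)
  qed
  have coeff: "fourier_coeff (\<lambda>x. \<Sum>k\<in>?E N. of_real a * e_fun k x) j = (if j \<in> ?E N then of_real a else 0)" for a N j
    by (rule fourier_coeff_const_sum) simp
  have ratio: "\<psi> N / Psi \<psi> k \<le> 1" if "k \<in> ?E N" "1 \<le> N" for N k
  proof -
    have "\<psi> N \<le> Psi \<psi> k"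
      unfolding Psi_eq[OF \<psi>] using that by (intro psi_antimono[OF \<psi>]) auto
    then show ?thesis using Psi_pos[OF \<psi>, of k] by simp
  qed
  have ratio_powr: "(\<psi> N / Psi \<psi> k) powr r \<le> 1" if "k \<in> ?E N" "1 \<le> N" "0 < r" for N k r
    using ratio[OF that(1,2)] that psi_pos[OF \<psi>, of N] Psi_pos[OF \<psi>, of k]
    by (intro powr_le1) auto
  show thesis
  proof (cases "q = \<infinity>")
    case True
    have "(\<lambda>x. \<Sum>k\<in>?E N. of_real (1 * \<psi> N) * e_fun k x) \<in> F_class q \<psi>" if "1 \<le> N" for N
    proof -
      have "cmod ((if k \<in> ?E N then of_real (1 * \<psi> N) else 0) / of_real (Psi \<psi> k)) \<le> 1" for k
        using ratio[of k N] that psi_pos[OF \<psi>, of N] Psi_pos[OF \<psi>, of k]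
        by (simp add: norm_divide)
      then have "lq_norm q (\<lambda>k. fourier_coeff (\<lambda>x. \<Sum>k\<in>?E N. of_real (1 * \<psi> N) * e_fun k x) k
          / of_real (Psi \<psi> k)) \<le> 1"
        unfolding coeff lq_norm_def if_P[OF True] by (intro SUP_least) simp
      then show ?thesis
        unfolding F_class_def using L1 by blast
    qed
    then show ?thesis using that[of 1] by simp
  next
    case False
    define r where "r = enn2real q"
    have r: "0 < r" using q False by (simp add: r_def enn2real_positive_iff less_top)
    obtain \<theta> where \<theta>: "0 < \<theta>" "\<theta> < 1" "\<And>t. 1 \<le> t \<Longrightarrow> \<psi> (t + 1) \<le> \<theta> * \<psi> t"
      using psi_geometric_decay[OF \<psi>] by metis
    define \<eta> where "\<eta> = \<theta> powr r"
    have \<eta>: "0 < \<eta>" "\<eta> < 1" using \<theta> r powr_less_mono2[of r \<theta> 1] by (auto simp: \<eta>_def)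
    \<comment> \<open>Passing from \<open>N\<close> to \<open>N + 1\<close> scales the old terms by
      at most \<open>\<eta>\<close> and adds two terms of size at most 1. This \<open>K\<close> is
      preserved, as \<open>\<eta> * K + 2 \<le> K\<close>, and covers the three terms of the base
      case.\<close>
    define K where "K = 3 / (1 - \<eta>)"
    have "0 < K" using \<eta> by (simp add: K_def)
    moreover have "K * (1 - \<eta>) = 3"
      using \<eta> by (intro nonzero_eq_divide_eq[THEN iffD1]) (auto simp: K_def)
    moreover have "0 < \<eta> * K" using \<eta> \<open>0 < K\<close> by simp
    ultimately have K: "0 < K" "\<eta> * K + 2 \<le> K" "3 \<le> K"
      by (simp_all add: right_diff_distrib mult.commute)
    have T: "(\<Sum>k\<in>?E N. (\<psi> N / Psi \<psi> k) powr r) \<le> K" if "1 \<le> N" for N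
      using that
    proof (induction N rule: dec_induct)
      case base
      have "(\<Sum>k\<in>?E 1. (\<psi> (real 1) / Psi \<psi> k) powr r) \<le> (\<Sum>k\<in>?E 1. 1)"
        using r by (intro sum_mono ratio_powr) auto
      then show ?case using K by simp
    next
      case (step N)
      have E: "?E (Suc N) = insert (int (Suc N)) (insert (- int (Suc N)) (?E N))" by auto
      have "(\<Sum>k\<in>?E N. (\<psi> (Suc N) / Psi \<psi> k) powr r) \<le> (\<Sum>k\<in>?E N. \<eta> * (\<psi> N / Psi \<psi> k) powr r)"
      proof (rule sum_mono)
        fix k
        have "\<psi> (Suc N) / Psi \<psi> k \<le> \<theta> * (\<psi> N / Psi \<psi> k)"
          using \<theta>(3)[of N] step.hyps Psi_pos[OF \<psi>, of k]
          by (simp add: divide_right_mono add.commute)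
        then have "(\<psi> (Suc N) / Psi \<psi> k) powr r \<le> (\<theta> * (\<psi> N / Psi \<psi> k)) powr r"
          using r Psi_pos[OF \<psi>, of k] psi_pos[OF \<psi>, of "Suc N"] by (intro powr_mono2) auto
        then show "(\<psi> (Suc N) / Psi \<psi> k) powr r \<le> \<eta> * (\<psi> N / Psi \<psi> k) powr r"
          unfolding \<eta>_def using \<theta> step.hyps Psi_pos[OF \<psi>, of k] psi_pos[OF \<psi>, of N]
          by (subst (asm) powr_mult) auto
      qed
      also have "\<dots> \<le> \<eta> * K"
        using step.IH \<eta> by (simp add: mult_left_mono flip: sum_distrib_left)
      finally have "(\<Sum>k\<in>?E N. (\<psi> (Suc N) / Psi \<psi> k) powr r) \<le> \<eta> * K" .
      moreover have "(\<psi> (Suc N) / Psi \<psi> k) powr r \<le> 1" if "k \<in> ?E (Suc N)" for k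
        using r that by (intro ratio_powr) auto
      from this[of "int (Suc N)"] this[of "- int (Suc N)"]
      have "(\<psi> (Suc N) / Psi \<psi> (int (Suc N))) powr r \<le> 1" "(\<psi> (Suc N) / Psi \<psi> (- int (Suc N))) powr r \<le> 1"
        by auto
      ultimately show ?case
        unfolding E using K(2) by (subst sum.insert; (subst sum.insert)?) (auto simp del: of_nat_Suc)
    qed
    \<comment> \<open>Chosen so that \<open>c powr r * K = 1\<close>.\<close>
    define c where "c = K powr (- (1 / r))"
    have c: "0 < c" "c powr r = 1 / K"
      unfolding c_def powr_powr using K r by (simp_all add: powr_minus_divide)
    have "(\<lambda>x. \<Sum>k\<in>?E N. of_real (c * \<psi> N) * e_fun k x) \<in> F_class q \<psi>" if N: "1 \<le> N" for N
    proof -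
      have "lq_norm q (\<lambda>k. (if k \<in> ?E N then of_real (c * \<psi> N) else 0) / of_real (Psi \<psi> k)) \<le> 1"
      proof (rule lq_norm_le_1I[OF q False, of "?E N"])
        have "(\<Sum>k\<in>?E N. cmod ((if k \<in> ?E N then of_real (c * \<psi> N) else 0) / of_real (Psi \<psi> k)) powr enn2real q)
          = (\<Sum>k\<in>?E N. c powr r * (\<psi> N / Psi \<psi> k) powr r)"
        proof (rule sum.cong[OF refl])
          fix k assume "k \<in> ?E N"
          then have norm_eq: "cmod ((if k \<in> ?E N then of_real (c * \<psi> N) else 0) / of_real (Psi \<psi> k)) = c * (\<psi> N / Psi \<psi> k)"
            using c psi_pos[OF \<psi>, of N] N Psi_pos[OF \<psi>, of k]
            by (simp add: norm_divide norm_mult)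
          show "cmod ((if k \<in> ?E N then of_real (c * \<psi> N) else 0) / of_real (Psi \<psi> k)) powr enn2real q
            = c powr r * (\<psi> N / Psi \<psi> k) powr r"
            unfolding norm_eq r_def[symmetric]
            using c psi_pos[OF \<psi>, of N] N Psi_pos[OF \<psi>, of k]
            by (subst powr_mult) auto
        qed
        also have "\<dots> = 1 / K * (\<Sum>k\<in>?E N. (\<psi> N / Psi \<psi> k) powr r)"
          by (simp add: c sum_distrib_left)
        also have "\<dots> \<le> 1" using T[OF N] K by simp
        finally show "(\<Sum>k\<in>?E N. cmod ((if k \<in> ?E N then of_real (c * \<psi> N) else 0) / of_real (Psi \<psi> k)) powr enn2real q) \<le> 1" .
      qed auto
      then have "lq_norm q (\<lambda>k. fourier_coeff (\<lambda>x. \<Sum>k\<in>?E N. of_real (c * \<psi> N) * e_fun k x) k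
          / of_real (Psi \<psi> k)) \<le> 1"
        unfolding coeff .
      then show ?thesis
        unfolding F_class_def using L1 by blast
    qed
    with c(1) that show ?thesis by blast
  qed
qed

lemma F_class_remainder_le:
  assumes "1 \<le> p" and f: "f \<in> F_class q \<psi>" and "inj \<kappa>"
    and "\<And>j. j \<notin> range \<kappa> \<Longrightarrow> fourier_coeff f j = 0"
    and "\<And>l. cmod (fourier_coeff f (\<kappa> l)) \<le> psi_star \<psi> l"
    and C: "(\<Sum>j. psi_star \<psi> (j + m)) \<le> C * psi_star \<psi> m" "summable (psi_star \<psi>)"
  shows "Lp_norm p (\<lambda>x. f x - (\<Sum>l<m. fourier_coeff f (\<kappa> l) * e_fun (\<kappa> l) x))
    \<le> ennreal (C * psi_star \<psi> m)"
proof -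
  have "Lp_norm p (\<lambda>x. f x - (\<Sum>l<m. fourier_coeff f (\<kappa> l) * e_fun (\<kappa> l) x))
    \<le> ennreal (\<Sum>j. psi_star \<psi> (j + m))"
    using assms by (intro Lp_norm_remainder_le F_class_integrable)
  also have "\<dots> \<le> ennreal (C * psi_star \<psi> m)"
    using C by (intro ennreal_leI)
  finally show ?thesis .
qed

text \<open>The infimum over greedy orders needs just one witness, but also needs it to exist;
  finite superlevel sets of the weights provide it.\<close>

lemma G_greedy_upper:
  assumes p: "1 \<le> p"
    and C: "(\<Sum>j. psi_star \<psi> (j + m)) \<le> C * psi_star \<psi> m" "summable (psi_star \<psi>)"
  shows "G_greedy m (F_class q \<psi>) p \<le> ennreal (C * psi_star \<psi> m)"
  unfolding G_greedy_def
proof (rule SUP_least)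
  fix f assume f: "f \<in> F_class q \<psi>"
  have le: "cmod (fourier_coeff f k) \<le> Psi \<psi> k" for k
    using f by (rule F_class_coeff_le)
  have fin: "finite {k. \<epsilon> \<le> cmod (fourier_coeff f k)}" if "0 < \<epsilon>" for \<epsilon>
    by (rule finite_subset[OF _ finite_Psi_ge[OF \<psi> that]]) (use le order_trans in blast)
  have "\<exists>\<kappa>::nat \<Rightarrow> int. inj \<kappa> \<and> antimono (\<lambda>l. cmod (fourier_coeff f (\<kappa> l))) \<and>
      (\<forall>j. j \<notin> range \<kappa> \<longrightarrow> cmod (fourier_coeff f j) = 0)"
    by (rule exists_nonincreasing_enumeration[OF infinite_UNIV_int norm_ge_zero fin])
  then obtain \<kappa> :: "nat \<Rightarrow> int" where \<kappa>: "inj \<kappa>" "antimono (\<lambda>l. cmod (fourier_coeff f (\<kappa> l)))"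
    "\<And>j. j \<notin> range \<kappa> \<Longrightarrow> cmod (fourier_coeff f j) = 0"
    by blast
  then have "\<kappa> \<in> greedy_orders f" by (auto simp: greedy_orders_def)
  then show "(INF \<kappa>\<in>greedy_orders f. Lp_norm p (\<lambda>x. f x - (\<Sum>l<m. fourier_coeff f (\<kappa> l) * e_fun (\<kappa> l) x)))
      \<le> ennreal (C * psi_star \<psi> m)"
  proof (rule INF_lower2)
    show "Lp_norm p (\<lambda>x. f x - (\<Sum>l<m. fourier_coeff f (\<kappa> l) * e_fun (\<kappa> l) x)) \<le> ennreal (C * psi_star \<psi> m)"
      using \<kappa> le_psi_star[OF \<psi> \<kappa>(1,2) le]
      by (intro F_class_remainder_le p f C) auto
  qed
qed

text \<open>The set of frequencies must serve all \<open>f\<close> at once, so it is read off from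
  the common weights instead of the coefficients.\<close>

lemma D_perp_upper:
  assumes p: "1 \<le> p"
    and C: "(\<Sum>j. psi_star \<psi> (j + m)) \<le> C * psi_star \<psi> m" "summable (psi_star \<psi>)"
  shows "D_perp m (F_class q \<psi>) p \<le> ennreal (C * psi_star \<psi> m)"
proof -
  have "\<exists>\<kappa>::nat \<Rightarrow> int. inj \<kappa> \<and> antimono (\<lambda>l. Psi \<psi> (\<kappa> l)) \<and> (\<forall>j. j \<notin> range \<kappa> \<longrightarrow> Psi \<psi> j = 0)"
    by (rule exists_nonincreasing_enumeration[OF infinite_UNIV_int])
      (use \<psi> in \<open>auto intro: less_imp_le[OF Psi_pos] finite_Psi_ge\<close>)
  then obtain \<kappa> :: "nat \<Rightarrow> int" where \<kappa>: "inj \<kappa>" "antimono (\<lambda>l. Psi \<psi> (\<kappa> l))"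
    "\<And>j. j \<notin> range \<kappa> \<Longrightarrow> Psi \<psi> j = 0"
    by blast
  \<comment> \<open>The weights are positive, so no index is omitted and the enumeration is a
    bijection.\<close>
  then have surj: "j \<in> range \<kappa>" for j
    using Psi_pos[OF \<psi>, of j] by (cases "j \<in> range \<kappa>") auto
  have "\<kappa> ` {..<m} \<in> Gamma_sets m"
    using \<kappa>(1) by (simp add: Gamma_sets_def card_image inj_on_subset)
  then show ?thesis
    unfolding D_perp_def
  proof (rule INF_lower2, intro SUP_least)
    fix f assume f: "f \<in> F_class q \<psi>"
    have sum_eq: "fourier_sum (\<kappa> ` {..<m}) f x = (\<Sum>l<m. fourier_coeff f (\<kappa> l) * e_fun (\<kappa> l) x)" for x
      unfolding fourier_sum_def using \<kappa>(1) by (subst sum.reindex) (auto intro: inj_on_subset)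
    have le: "cmod (fourier_coeff f (\<kappa> l)) \<le> psi_star \<psi> l" for l
      by (rule order_trans[OF F_class_coeff_le[OF f] le_psi_star[OF \<psi> \<kappa>(1,2) order_refl]])
    show "Lp_norm p (\<lambda>x. f x - fourier_sum (\<kappa> ` {..<m}) f x) \<le> ennreal (C * psi_star \<psi> m)"
      unfolding sum_eq by (rule F_class_remainder_le[OF p f \<kappa>(1) _ le C]) (use surj in auto)
  qed
qed

text \<open>One test function defeats every choice of \<open>m\<close> frequencies, and a single
  surviving coefficient bounds the norm from below for all \<open>p \<ge> 1\<close>.\<close>

lemma sigma_perp_lower:
  assumes p: "1 \<le> p" and m: "1 \<le> m" and c: "0 < c"
    and c_class: "\<And>N::nat. 1 \<le> N \<Longrightarrow>
    (\<lambda>x. \<Sum>k\<in>{- int N..int N}. of_real (c * \<psi> N) * e_fun k x) \<in> F_class q \<psi>"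
  shows "ennreal (c * psi_star \<psi> m) \<le> sigma_perp m (F_class q \<psi>) p"
proof -
  define N where "N = (m + 1) div 2"
  have N: "1 \<le> N" "m < 2 * N + 1" using m by (auto simp: N_def)
  let ?E = "{- int N..int N}"
  define a where "a = c * \<psi> N"
  define f where "f = (\<lambda>x. \<Sum>k\<in>?E. of_real a * e_fun k x)"
  have f: "f \<in> F_class q \<psi>"
    unfolding f_def a_def using N(1) by (rule c_class)
  have a: "0 < a" using c psi_pos[OF \<psi>, of N] N by (simp add: a_def)
  have coeff: "fourier_coeff f j = (if j \<in> ?E then of_real a else 0)" for j
    unfolding f_def by (rule fourier_coeff_const_sum) simp
  have "ennreal a \<le> Lp_norm p (\<lambda>x. f x - fourier_sum \<gamma> f x)" if "\<gamma> \<in> Gamma_sets m" for \<gamma>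
  proof -
    have \<gamma>: "finite \<gamma>" "card \<gamma> = m" using that by (auto simp: Gamma_sets_def)
    have "\<not> ?E \<subseteq> \<gamma>"
    proof
      assume "?E \<subseteq> \<gamma>"
      then have "card ?E \<le> m" using card_mono[OF \<gamma>(1)] \<gamma>(2) by metis
      moreover have "card ?E = 2 * N + 1" by (simp add: nat_eq_iff)
      ultimately show False using N(2) by simp
    qed
    then obtain k where k: "k \<in> ?E" "k \<notin> \<gamma>" by blast
    have int: "integrable circle_measure (fourier_sum \<gamma> f)"
      unfolding fourier_sum_def by (intro Bochner_Integration.integrable_sum integrable_e_fun)
    \<comment> \<open>The subtracted sum lacks the frequency \<open>k\<close>, so the remainder
      retains the full coefficient \<open>a\<close> there.\<close>
    have "fourier_coeff (fourier_sum \<gamma> f) k = 0"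
      unfolding fourier_sum_def using k(2)
      by (simp add: fourier_coeff_sum[OF \<gamma>(1)] integrable_e_fun fourier_coeff_cmult fourier_coeff_e_fun)
        (auto intro!: sum.neutral)
    then have "fourier_coeff (\<lambda>x. f x - fourier_sum \<gamma> f x) k = of_real a"
      using fourier_coeff_diff[OF F_class_integrable[OF f] int] k coeff by simp
    moreover have "integrable circle_measure (\<lambda>x. f x - fourier_sum \<gamma> f x)"
      using F_class_integrable[OF f] int by simp
    ultimately show ?thesis
      using fourier_coeff_le_Lp_norm[OF p, of "\<lambda>x. f x - fourier_sum \<gamma> f x" k] a by simp
  qed
  then have "ennreal a \<le> (INF \<gamma>\<in>Gamma_sets m. Lp_norm p (\<lambda>x. f x - fourier_sum \<gamma> f x))"
    by (rule INF_greatest)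
  also have "\<dots> \<le> sigma_perp m (F_class q \<psi>) p"
    unfolding sigma_perp_def using f by (rule SUP_upper)
  finally show ?thesis
    by (simp add: a_def psi_star_eq[OF \<psi> m] N_def)
qed

end

section \<open>Comparison of the quantities and the chain of equivalences\<close>

text \<open>The usual inequality between sup-inf and inf-sup.\<close>

lemma sigma_perp_le_D_perp: "sigma_perp m N p \<le> D_perp m N p"
  unfolding sigma_perp_def D_perp_def
  by (intro SUP_least INF_greatest) (meson INF_lower2 SUP_upper order_refl order_trans)

text \<open>The first \<open>m\<close> indices of a greedy order form an admissible choice.\<close>

lemma sigma_perp_le_G_greedy: "sigma_perp m N p \<le> G_greedy m N p"
  unfolding sigma_perp_def G_greedy_def
proof (intro SUP_mono')
  fix f
  show "(INF \<gamma>\<in>Gamma_sets m. Lp_norm p (\<lambda>x. f x - fourier_sum \<gamma> f x))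
    \<le> (INF \<kappa>\<in>greedy_orders f. Lp_norm p (\<lambda>x. f x - (\<Sum>l<m. fourier_coeff f (\<kappa> l) * e_fun (\<kappa> l) x)))"
  proof (rule INF_mono)
    fix \<kappa> assume "\<kappa> \<in> greedy_orders f"
    then have "inj_on \<kappa> {..<m}" by (auto simp: greedy_orders_def intro: inj_on_subset)
    then have "\<kappa> ` {..<m} \<in> Gamma_sets m"
      and "fourier_sum (\<kappa> ` {..<m}) f x = (\<Sum>l<m. fourier_coeff f (\<kappa> l) * e_fun (\<kappa> l) x)" for x
      by (auto simp: Gamma_sets_def card_image fourier_sum_def sum.reindex)
    then show "\<exists>\<gamma>\<in>Gamma_sets m. Lp_norm p (\<lambda>x. f x - fourier_sum \<gamma> f x)
      \<le> Lp_norm p (\<lambda>x. f x - (\<Sum>l<m. fourier_coeff f (\<kappa> l) * e_fun (\<kappa> l) x))"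
      by (intro bexI[of _ "\<kappa> ` {..<m}"]) auto
  qed
qed

lemma asymp_order_from_sandwich:
  fixes b :: "nat \<Rightarrow> ennreal"
  assumes pos: "0 < c" "0 < C" "0 < c'" "0 < C'"
    and a: "\<And>m. m0 \<le> m \<Longrightarrow> ennreal c * b m \<le> a m" "\<And>m. m0 \<le> m \<Longrightarrow> a m \<le> ennreal C * b m"
    and a': "\<And>m. m0 \<le> m \<Longrightarrow> ennreal c' * b m \<le> a' m" "\<And>m. m0 \<le> m \<Longrightarrow> a' m \<le> ennreal C' * b m"
  shows "asymp_order_from m0 a a'"
  unfolding asymp_order_from_def
proof (intro exI conjI allI impI)
  \<comment> \<open>\<open>C / c'\<close> alone is a valid upper constant; adding
    \<open>c / C'\<close> secures the strict inequality between the two constants.\<close>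
  let ?K1 = "c / C'" and ?K2 = "C / c' + c / C'"
  show "0 < ?K1" "?K1 < ?K2" using pos by auto
  fix m assume m: "m0 \<le> m"
  have "ennreal ?K1 * a' m \<le> ennreal ?K1 * (ennreal C' * b m)"
    by (intro mult_left_mono a' m) auto
  also have "\<dots> = ennreal c * b m"
    using pos by (simp flip: mult.assoc ennreal_mult)
  finally show "ennreal ?K1 * a' m \<le> a m" using a(1)[OF m] by (rule order_trans)
  have "a m \<le> ennreal C * b m" by (rule a(2)[OF m])
  also have "\<dots> = ennreal (C / c') * (ennreal c' * b m)"
    using pos by (simp flip: mult.assoc ennreal_mult)
  also have "\<dots> \<le> ennreal (C / c') * a' m"
    by (intro mult_left_mono a' m) auto
  also have "\<dots> \<le> ennreal ?K2 * a' m"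
    using pos by (intro mult_right_mono ennreal_leI) auto
  finally show "a m \<le> ennreal ?K2 * a' m" .
qed

theorem theorem8:
  fixes p :: real and q :: ennreal and \<psi> :: "real \<Rightarrow> real"
  assumes "1 \<le> p" and "0 < q" and "\<psi> \<in> M_c_inf"
  shows "asymp_order_from 1 (\<lambda>m. sigma_perp m (F_class q \<psi>) p) (\<lambda>m. G_greedy m (F_class q \<psi>) p) \<and>
    asymp_order_from 1 (\<lambda>m. G_greedy m (F_class q \<psi>) p) (\<lambda>m. D_perp m (F_class q \<psi>) p) \<and>
    asymp_order_from 1 (\<lambda>m. D_perp m (F_class q \<psi>) p)
      (\<lambda>m. ennreal (\<psi> (of_int \<lfloor>(real m + 1) / 2\<rfloor>))) \<and>
    asymp_order_from 2 (\<lambda>m. D_perp m (F_class q \<psi>) p) (\<lambda>m. ennreal (\<psi> (real m / 2))) \<and>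
    asymp_order_from 2 (\<lambda>m. ennreal (\<psi> (real m / 2)))
      (\<lambda>m. ennreal (\<psi> (of_int \<lfloor>(real m + 1) / 2\<rfloor>)))"
proof -
  let ?F = "F_class q \<psi>"
  let ?b = "\<lambda>m. ennreal (\<psi> (of_int \<lfloor>(real m + 1) / 2\<rfloor>))"
  note \<psi> = assms(3)
  have b: "?b m = ennreal (psi_star \<psi> m)" if "1 \<le> m" for m
    using that floor_divide_of_nat_eq[of "m + 1" 2, where ?'a = real]
    by (simp add: psi_star_eq[OF \<psi>] add.commute)
  obtain c where c: "0 < c" "\<And>N::nat. 1 \<le> N \<Longrightarrow>
    (\<lambda>x. \<Sum>k\<in>{- int N..int N}. of_real (c * \<psi> N) * e_fun k x) \<in> ?F"
    using F_class_trig_poly[OF \<psi> assms(2)] by metis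
  obtain C where C: "0 < C" "summable (psi_star \<psi>)"
    "\<And>m. 1 \<le> m \<Longrightarrow> (\<Sum>j. psi_star \<psi> (j + m)) \<le> C * psi_star \<psi> m"
    using psi_star_tail[OF \<psi>] by metis
  obtain S where S: "1 \<le> S" "\<And>t. 1 \<le> t \<Longrightarrow> \<psi> t \<le> S * \<psi> (t + 1)"
    using psi_shift_bound[OF \<psi>] by metis
  have sigma: "ennreal c * ?b m \<le> sigma_perp m ?F p" if "1 \<le> m" for m
    using sigma_perp_lower[OF \<psi> assms(2,1) that c] c(1) b[OF that]
    by (simp add: ennreal_mult' less_imp_le)
  have G: "G_greedy m ?F p \<le> ennreal C * ?b m" if "1 \<le> m" for m
    using G_greedy_upper[OF \<psi> assms(2,1) C(3)[OF that] C(2)] C(1) b[OF that]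
    by (simp add: ennreal_mult' less_imp_le)
  have D: "D_perp m ?F p \<le> ennreal C * ?b m" if "1 \<le> m" for m
    using D_perp_upper[OF \<psi> assms(2,1) C(3)[OF that] C(2)] C(1) b[OF that]
    by (simp add: ennreal_mult' less_imp_le)
  have sigma': "sigma_perp m ?F p \<le> ennreal C * ?b m" if "1 \<le> m" for m
    using sigma_perp_le_D_perp D[OF that] by (rule order_trans)
  have G': "ennreal c * ?b m \<le> G_greedy m ?F p" if "1 \<le> m" for m
    using sigma[OF that] sigma_perp_le_G_greedy by (rule order_trans)
  have D': "ennreal c * ?b m \<le> D_perp m ?F p" if "1 \<le> m" for m
    using sigma[OF that] sigma_perp_le_D_perp by (rule order_trans)
  \<comment> \<open>The two arguments differ by at most 1, so monotonicity and the shift bound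
    compare the values; \<open>m \<ge> 2\<close> keeps \<open>m / 2\<close> in the domain.\<close>
  have half: "ennreal 1 * ?b m \<le> ennreal (\<psi> (real m / 2))" "ennreal (\<psi> (real m / 2)) \<le> ennreal S * ?b m"
    if m: "2 \<le> m" for m
  proof -
    have fl: "real m / 2 \<le> of_int \<lfloor>(real m + 1) / 2\<rfloor>" "of_int \<lfloor>(real m + 1) / 2\<rfloor> \<le> real m / 2 + 1"
    proof -
      have "m \<le> 2 * ((m + 1) div 2)" "2 * ((m + 1) div 2) \<le> m + 2" by simp_all
      then have "real m \<le> real (2 * ((m + 1) div 2))" "real (2 * ((m + 1) div 2)) \<le> real (m + 2)"
        by (simp_all only: of_nat_le_iff)
      moreover have "of_int \<lfloor>(real m + 1) / 2\<rfloor> = real ((m + 1) div 2)"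
        using floor_divide_of_nat_eq[of "m + 1" 2, where ?'a = real] by (simp add: add.commute)
      ultimately show "real m / 2 \<le> of_int \<lfloor>(real m + 1) / 2\<rfloor>" "of_int \<lfloor>(real m + 1) / 2\<rfloor> \<le> real m / 2 + 1"
        by simp_all
    qed
    have "\<psi> (of_int \<lfloor>(real m + 1) / 2\<rfloor>) \<le> \<psi> (real m / 2)"
      using m fl by (intro psi_antimono[OF \<psi>]) auto
    then show "ennreal 1 * ?b m \<le> ennreal (\<psi> (real m / 2))"
      by (simp add: ennreal_leI)
    have "\<psi> (real m / 2) \<le> S * \<psi> (real m / 2 + 1)"
      using m by (intro S) simp
    also have "\<dots> \<le> S * \<psi> (of_int \<lfloor>(real m + 1) / 2\<rfloor>)"
      using m fl S(1) by (intro mult_left_mono psi_antimono[OF \<psi>]) auto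
    finally show "ennreal (\<psi> (real m / 2)) \<le> ennreal S * ?b m"
      using S(1) by (subst ennreal_mult'[symmetric]) (auto intro: ennreal_leI)
  qed
  have S0: "0 < S" using S(1) by simp
  show ?thesis
  \<comment> \<open>Every quantity lies between multiples of \<open>?b\<close>, so each pair is
    compared through it.\<close>
  proof (intro conjI)
    show "asymp_order_from 1 (\<lambda>m. sigma_perp m ?F p) (\<lambda>m. G_greedy m ?F p)"
      by (rule asymp_order_from_sandwich[OF c(1) C(1) c(1) C(1) sigma sigma' G' G])
    show "asymp_order_from 1 (\<lambda>m. G_greedy m ?F p) (\<lambda>m. D_perp m ?F p)"
      by (rule asymp_order_from_sandwich[OF c(1) C(1) c(1) C(1) G' G D' D])
    show "asymp_order_from 1 (\<lambda>m. D_perp m ?F p) ?b"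
      by (rule asymp_order_from_sandwich[OF c(1) C(1) zero_less_one zero_less_one D' D]) auto
    show "asymp_order_from 2 (\<lambda>m. D_perp m ?F p) (\<lambda>m. ennreal (\<psi> (real m / 2)))"
      by (rule asymp_order_from_sandwich[OF c(1) C(1) zero_less_one S0 D' D half]) auto
    show "asymp_order_from 2 (\<lambda>m. ennreal (\<psi> (real m / 2))) ?b"
      by (rule asymp_order_from_sandwich[OF zero_less_one S0 zero_less_one zero_less_one half]) auto
  qed
qed

end
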